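(* Let $1<p<\infty$ and let $\varphi$ be an analytic self-map of $\mathbb D$. Suppose $\omega\in\mathcal R$ satisfies: (i) there is a constant $C>0$ such that $\hat\omega\left(\frac{t-r}{1-tr}\right)\hat\omega(r)\le C\,\hat\omega(t)$ for all $0\le r\le t<1$; (ii) $2A+AB-B>0$, where $A=\liminf_{t\to1}\frac{\int_t^1\omega(s)\,ds}{(1-t)\omega(t)}$ and $B=\limsup_{t\to1}\frac{\int_t^1\omega(s)\,ds}{(1-t)\omega(t)}$. Let $X=\{u\in H(\mathbb D):uC_\varphi(A_\omega^p)\subset A_\omega^p\}$. If $X=H^\infty$, then $\varphi$ is a finite Blaschke product.
   Context: $\mathbb D$ is the open unit disk in $\mathbb C$, $H(\mathbb D)$ is the set of analytic functions on $\mathbb D$, $H^\infty$ is the set of bounded analytic functions on $\mathbb D$, and $dA(z)=\frac1\pi dx\,dy$. A weight is a positive radial function $\omega$ on $\mathbb D$, $\omega(z)=\omega(|z|)$, integrable on $(0,1)$; put $\hat\omega(r)=\int_r^1\omega(s)\,ds$. The weight $\omega$ is regular, written $\omega\in\mathcal R$, if there is a constant $C>0$ depending on $\omega$ such that $\frac1C<\frac{\hat\omega(r)}{(1-r)\omega(r)}<C$ for all $0<r<1$. $A_\omega^p$ is the space of $f\in H(\mathbb D)$ with $\|f\|_{A_\omega^p}^p=\int_{\mathbb D}|f|^p\omega\,dA<\infty$. The weighted composition operator is $(uC_\varphi f)(z)=u(z)f(\varphi(z))$. *)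

theory Defs
  imports "HOL-Complex_Analysis.Complex_Analysis"
begin

text \<open>
  Functions on the disk are total functions on \<^typ>\<open>complex\<close>; everything below depends
  only on their values on the unit disk, so values elsewhere are irrelevant.
\<close>

abbreviation unit_disk :: "complex set" where
  "unit_disk \<equiv> ball 0 1"

definition area_measure :: "complex measure" where
  "area_measure = scale_measure (ennreal (1 / pi)) lebesgue"

definition weight :: "(complex \<Rightarrow> real) \<Rightarrow> bool" where
  "weight \<omega> \<longleftrightarrow>
     (\<forall>z\<in>unit_disk. 0 < \<omega> z) \<and>
     (\<forall>z\<in>unit_disk. \<omega> z = \<omega> (complex_of_real (cmod z))) \<and>
     set_integrable lebesgue {0<..<1} (\<lambda>s. \<omega> (complex_of_real s))"

definition tail_integral :: "(complex \<Rightarrow> real) \<Rightarrow> real \<Rightarrow> real" where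
  "tail_integral \<omega> r = (LINT s:{r<..<1}|lebesgue. \<omega> (complex_of_real s))"

definition tail_ratio :: "(complex \<Rightarrow> real) \<Rightarrow> real \<Rightarrow> real" where
  "tail_ratio \<omega> r = tail_integral \<omega> r / ((1 - r) * \<omega> (complex_of_real r))"

definition regular_weight :: "(complex \<Rightarrow> real) \<Rightarrow> bool" where
  "regular_weight \<omega> \<longleftrightarrow> weight \<omega> \<and>
     (\<exists>C>0. \<forall>r\<in>{0<..<1}. 1 / C < tail_ratio \<omega> r \<and> tail_ratio \<omega> r < C)"

text \<open>
  The limits are taken in the extended reals, where they always exist; for a regular weight
  both are finite and positive, so arithmetic with them is ordinary real arithmetic.
\<close>

definition lower_tail_ratio :: "(complex \<Rightarrow> real) \<Rightarrow> ereal" where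
  "lower_tail_ratio \<omega> = Liminf (at_left 1) (\<lambda>t. ereal (tail_ratio \<omega> t))"

definition upper_tail_ratio :: "(complex \<Rightarrow> real) \<Rightarrow> ereal" where
  "upper_tail_ratio \<omega> = Limsup (at_left 1) (\<lambda>t. ereal (tail_ratio \<omega> t))"

definition bergman_space :: "real \<Rightarrow> (complex \<Rightarrow> real) \<Rightarrow> (complex \<Rightarrow> complex) set" where
  "bergman_space p \<omega> = {f. f holomorphic_on unit_disk \<and>
     (\<integral>\<^sup>+z\<in>unit_disk. ennreal (cmod (f z) powr p * \<omega> z) \<partial>area_measure) < \<infinity>}"

definition H_infinity :: "(complex \<Rightarrow> complex) set" where
  "H_infinity = {f. f holomorphic_on unit_disk \<and> bounded (f ` unit_disk)}"

definition weighted_comp ::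
  "(complex \<Rightarrow> complex) \<Rightarrow> (complex \<Rightarrow> complex) \<Rightarrow> (complex \<Rightarrow> complex) \<Rightarrow> complex \<Rightarrow> complex" where
  "weighted_comp u \<phi> f = (\<lambda>z. u z * f (\<phi> z))"

text \<open>
  Zeros may repeat. Degree 0 (a unimodular constant) is allowed, as usual; it is never a
  map of the open disk into itself.
\<close>

definition finite_blaschke_product :: "(complex \<Rightarrow> complex) \<Rightarrow> bool" where
  "finite_blaschke_product \<phi> \<longleftrightarrow>
     (\<exists>(n::nat) (a :: nat \<Rightarrow> complex) c. cmod c = 1 \<and> (\<forall>k<n. a k \<in> unit_disk) \<and>
        (\<forall>z\<in>unit_disk. \<phi> z = c * (\<Prod>k<n. (z - a k) / (1 - cnj (a k) * z))))"

end

theory Submission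
  imports Defs
begin

text \<open>
  Only the inclusion of \<open>X\<close> in \<open>H\<^sup>\<infinity>\<close> matters. If \<open>\<phi>\<close> is not a finite Blaschke product, then
  \<open>|\<phi>|\<close> does not tend to 1 at the boundary, so there are points \<open>a\<^sub>j\<close> tending to the boundary at
  which \<open>|\<phi>|\<close> stays below some \<open>c < 1\<close>. Regularity makes the tail integral of the weight decay like a
  power of the distance to the boundary, so \<open>\<omega>(z) (1 - |z|)\<^bsup>-\<delta>\<^esup>\<close> is still integrable for small
  \<open>\<delta>\<close>, and with
  \<open>R(z) = (1 - |\<phi>(z)|) / (1 - |z|)\<close> the map \<open>f \<mapsto> f \<circ> \<phi>\<close> takes \<open>A\<^sup>p\<^sub>\<omega>\<close> into the space with the larger
  weight \<open>R\<^sup>\<delta> \<omega>\<close>. Hence \<open>u\<close> belongs to \<open>X\<close> as soon as \<open>|u|\<^sup>p \<le> M R\<^sup>\<delta>\<close>. By the Schwarz--Pick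
  inequality the functions \<open>(1 - |a\<^sub>j|\<^sup>2) / (1 - cnj a\<^sub>j z)\<close>, which equal 1 at \<open>a\<^sub>j\<close>, satisfy this with
  constants that tend to 0, and a gliding hump sum of large multiples of them is an unbounded element
  of \<open>X\<close>.
\<close>

section \<open>Area means of holomorphic functions\<close>

text \<open>The factor \<open>R\<^sup>\<delta>\<close> is in general neither bounded nor radial, so
  Littlewood subordination for radial weights does not yield the gain. Instead
  \<open>|f (\<phi> z)|^p\<close> is bounded by its mean over the disk about \<open>\<phi> z\<close>
  whose radius is half the boundary distance. Exchanging the integrals leaves, for each fixed
  \<open>\<zeta>\<close>, a weighted area of the \<open>z\<close> with \<open>\<phi> z\<close> near
  \<open>\<zeta>\<close>. Two facts control it. Schwarz--Pick at the origin makes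
  \<open>1 - |z|\<close> at most a constant times \<open>1 - |\<zeta>|\<close>. The mean value
  property of a positive harmonic function shows that such \<open>z\<close> fill at most a fraction
  of order \<open>1 - |\<zeta>|\<close> of every annulus about 0. Dyadic annuli then give a
  geometric series whose ratio is the decay of the tail per halving of the boundary distance, times
  \<open>2 powr \<delta>\<close>; this is what \<open>\<delta>\<close> must be small for. The
  multiplier uses \<open>\<eta> = \<delta> / p\<close>, and needs \<open>\<eta> \<le> 1 / 2\<close>
  because Schwarz--Pick controls the square of a peak.\<close>

lemma lborel_complex_eq_distr:
  "(lborel :: complex measure) = distr (lborel \<Otimes>\<^sub>M lborel) borel (\<lambda>(x, y). Complex x y)"
proof (rule lborel_eqI)
  fix l u :: complex
  assume le: "\<And>b. b \<in> Basis \<Longrightarrow> l \<bullet> b \<le> u \<bullet> b"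
  have meas: "(\<lambda>(x, y). Complex x y) \<in> borel_measurable (lborel \<Otimes>\<^sub>M lborel)"
    unfolding Complex_eq by measurable
  have vim: "(\<lambda>(x, y). Complex x y) -` box l u \<inter> space (lborel \<Otimes>\<^sub>M lborel)
      = {Re l<..<Re u} \<times> {Im l<..<Im u}"
    by (auto simp: in_box_complex_iff space_pair_measure)
  show "emeasure (distr (lborel \<Otimes>\<^sub>M lborel) borel (\<lambda>(x, y). Complex x y)) (box l u)
      = ennreal (\<Prod>b\<in>Basis. (u - l) \<bullet> b)"
    using le[of 1] le[of \<i>]
    by (subst emeasure_distr[OF meas])
       (auto simp: vim lborel.emeasure_pair_measure_Times Basis_complex_def ennreal_mult)
qed simp

lemma nn_integral_lborel_complex:
  assumes [measurable]: "f \<in> borel_measurable (borel :: complex measure)"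
  shows "(\<integral>\<^sup>+z. f z \<partial>lborel) = (\<integral>\<^sup>+y. \<integral>\<^sup>+x. f (Complex x y) \<partial>lborel \<partial>lborel)"
    and "(\<integral>\<^sup>+z. f z \<partial>lborel) = (\<integral>\<^sup>+x. \<integral>\<^sup>+y. f (Complex x y) \<partial>lborel \<partial>lborel)"
proof -
  interpret lborel_pair: pair_sigma_finite "lborel :: real measure" "lborel :: real measure" ..
  have meas[measurable]: "(\<lambda>(x, y). Complex x y) \<in> borel_measurable (lborel \<Otimes>\<^sub>M lborel)"
    unfolding Complex_eq by measurable
  have eq: "(\<integral>\<^sup>+z. f z \<partial>lborel) = (\<integral>\<^sup>+p. f (Complex (fst p) (snd p)) \<partial>(lborel \<Otimes>\<^sub>M lborel))"
    by (subst lborel_complex_eq_distr, subst nn_integral_distr) (auto simp: case_prod_unfold)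
  have m2: "(\<lambda>p. f (Complex (fst p) (snd p))) \<in> borel_measurable (lborel \<Otimes>\<^sub>M lborel)"
    using measurable_compose[OF meas assms] by (simp add: case_prod_unfold)
  show "(\<integral>\<^sup>+z. f z \<partial>lborel) = (\<integral>\<^sup>+x. \<integral>\<^sup>+y. f (Complex x y) \<partial>lborel \<partial>lborel)"
    unfolding eq using lborel.nn_integral_fst[OF m2] by simp
  show "(\<integral>\<^sup>+z. f z \<partial>lborel) = (\<integral>\<^sup>+y. \<integral>\<^sup>+x. f (Complex x y) \<partial>lborel \<partial>lborel)"
    unfolding eq using lborel_pair.nn_integral_snd[of "\<lambda>p. f (Complex (fst p) (snd p))"] m2 by simp
qed

text \<open>With the sheared coordinate integrated first, the shear is a translation on each line;
  the two directions use the two orders of integration.\<close>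

lemma nn_integral_lborel_shear:
  fixes t :: real
  assumes [measurable]: "f \<in> borel_measurable (borel :: complex measure)"
  shows "(\<integral>\<^sup>+z. f (Complex (Re z + t * Im z) (Im z)) \<partial>lborel) = (\<integral>\<^sup>+z. f z \<partial>lborel)"
    and "(\<integral>\<^sup>+z. f (Complex (Re z) (Im z + t * Re z)) \<partial>lborel) = (\<integral>\<^sup>+z. f z \<partial>lborel)"
proof -
  have shift: "(\<integral>\<^sup>+x. g (x + a) \<partial>lborel) = (\<integral>\<^sup>+x. g x \<partial>lborel)"
    if "g \<in> borel_measurable borel" for g :: "real \<Rightarrow> ennreal" and a
    using nn_integral_real_affine[OF that, of 1 a] by (simp add: add.commute)
  have m1: "(\<lambda>z. f (Complex (Re z + t * Im z) (Im z))) \<in> borel_measurable borel"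
    unfolding Complex_eq by measurable
  have m2: "(\<lambda>z. f (Complex (Re z) (Im z + t * Re z))) \<in> borel_measurable borel"
    unfolding Complex_eq by measurable
  have c1: "(\<lambda>x. f (Complex x y)) \<in> borel_measurable borel" for y
    unfolding Complex_eq by measurable
  have c2: "(\<lambda>y. f (Complex x y)) \<in> borel_measurable borel" for x
    unfolding Complex_eq by measurable
  show "(\<integral>\<^sup>+z. f (Complex (Re z + t * Im z) (Im z)) \<partial>lborel) = (\<integral>\<^sup>+z. f z \<partial>lborel)"
    unfolding nn_integral_lborel_complex(1)[OF m1] nn_integral_lborel_complex(1)[OF assms]
    using shift[OF c1] by simp
  show "(\<integral>\<^sup>+z. f (Complex (Re z) (Im z + t * Re z)) \<partial>lborel) = (\<integral>\<^sup>+z. f z \<partial>lborel)"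
    unfolding nn_integral_lborel_complex(2)[OF m2] nn_integral_lborel_complex(2)[OF assms]
    using shift[OF c2] by simp
qed

text \<open>A plane rotation is a product of three shears, each of which preserves area. The
  factorization degenerates at the half turn, hence \<open>c \<noteq> -1\<close>.\<close>

lemma lborel_distr_rotation:
  fixes c :: complex
  assumes c: "cmod c = 1" "c \<noteq> -1"
  shows "distr lborel borel (\<lambda>z. c * z) = (lborel :: complex measure)"
proof (rule measure_eqI)
  fix A :: "complex set" assume "A \<in> sets (distr lborel borel (\<lambda>z. c * z))"
  then have [measurable]: "A \<in> sets borel" by simp
  \<comment> \<open>For \<open>c = cis t\<close> these are \<open>- tan (t / 2)\<close> and
    \<open>sin t\<close>, the classical shear parameters.\<close>
  define a where "a = - Im c / (1 + Re c)"
  define b where "b = Im c"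
  define S where "S = (\<lambda>z. Complex (Re z + a * Im z) (Im z))"
  define T where "T = (\<lambda>z. Complex (Re z) (Im z + b * Re z))"
  have sq: "(Re c)\<^sup>2 + (Im c)\<^sup>2 = 1"
    using c(1) by (simp add: cmod_def)
  have ne: "1 + Re c \<noteq> 0"
  proof
    assume "1 + Re c = 0"
    then have "Re c = -1" by simp
    with sq have "c = -1" by (simp add: complex_eq_iff)
    with c show False by simp
  qed
  have ab: "1 + a * b = Re c"
    using ne sq unfolding a_def b_def by (simp add: field_simps power2_eq_square)
  have ac: "a * (1 + Re c) = - Im c"
    using ne unfolding a_def by simp
  have rot: "S (T (S z)) = c * z" for z
  proof (rule complex_eqI)
    have "Im (S (T (S z))) = b * Re z + (1 + a * b) * Im z"
      unfolding S_def T_def by (simp add: algebra_simps)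
    then show "Im (S (T (S z))) = Im (c * z)" unfolding ab by (simp add: b_def)
    have "Re (S (T (S z))) = (1 + a * b) * Re z + a * (1 + (1 + a * b)) * Im z"
      unfolding S_def T_def by (simp add: algebra_simps)
    also have "\<dots> = Re (c * z)" unfolding ab ac by simp
    finally show "Re (S (T (S z))) = Re (c * z)" .
  qed
  have meas: "f \<circ> S \<in> borel_measurable borel" "f \<circ> T \<in> borel_measurable borel"
    if [measurable]: "f \<in> borel_measurable borel" for f :: "complex \<Rightarrow> ennreal"
    unfolding S_def T_def comp_def Complex_eq by measurable
  have SI: "(\<integral>\<^sup>+z. (f \<circ> S) z \<partial>lborel) = (\<integral>\<^sup>+z. f z \<partial>lborel)"
    "(\<integral>\<^sup>+z. (f \<circ> T) z \<partial>lborel) = (\<integral>\<^sup>+z. f z \<partial>lborel)"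
    if "f \<in> borel_measurable borel" for f
    using nn_integral_lborel_shear[OF that] by (simp_all add: S_def T_def)
  have m: "(indicator A :: complex \<Rightarrow> ennreal) \<in> borel_measurable borel" by measurable
  have "emeasure (distr lborel borel (\<lambda>z. c * z)) A
      = (\<integral>\<^sup>+z. indicator A (c * z) \<partial>lborel)"
    using nn_integral_distr[of "\<lambda>z. c * z" lborel borel "indicator A"] by simp
  also have "\<dots> = (\<integral>\<^sup>+z. (((indicator A \<circ> S) \<circ> T) \<circ> S) z \<partial>lborel)"
    by (simp add: rot)
  also have "\<dots> = emeasure lborel A"
    using SI(1)[OF meas(2)[OF meas(1)[OF m]]] SI(2)[OF meas(1)[OF m]] SI(1)[OF m] by simp
  finally show "emeasure (distr lborel borel (\<lambda>z. c * z)) A = emeasure lborel A" .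
qed simp

text \<open>A rotation \<open>c\<close> with \<open>c ^ n = \<i>\<close> preserves the disk and
  multiplies the integrand by \<open>\<i>\<close>, so the integral equals \<open>\<i>\<close> times
  itself.\<close>

lemma set_integral_power_ball_0:
  fixes r :: real
  assumes n: "0 < n"
  shows "(LINT z:ball 0 r|lborel. (z::complex) ^ n) = 0"
proof -
  \<comment> \<open>Aiming at \<open>\<i>\<close> rather than -1 keeps the angle at most
    \<open>pi / 2\<close>, so that \<open>c \<noteq> -1\<close> even for
    \<open>n = 1\<close>.\<close>
  define c where "c = cis (pi / (2 * real n))"
  have c1: "cmod c = 1" by (simp add: c_def)
  have "0 \<le> cos (pi / (2 * real n))"
  proof (rule cos_ge_zero)
    have "0 \<le> pi / (2 * real n)" by simp
    then show "- (pi / 2) \<le> pi / (2 * real n)" using pi_gt_zero by linarith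
    show "pi / (2 * real n) \<le> pi / 2" using n by (intro divide_left_mono) auto
  qed
  then have c2: "c \<noteq> -1" by (auto simp: c_def complex_eq_iff)
  have cn: "c ^ n = \<i>"
  proof -
    have "c ^ n = cis (real n * (pi / (2 * real n)))" unfolding c_def by (rule Complex.DeMoivre)
    also have "real n * (pi / (2 * real n)) = pi / 2" using n by simp
    finally show ?thesis by simp
  qed
  let ?I = "\<lambda>z. indicator (ball 0 r) z *\<^sub>R (z::complex) ^ n"
  have ind: "indicator (ball 0 r) (c * z) = (indicator (ball 0 r) z :: real)" for z
    by (simp add: indicator_def norm_mult c1)
  have meas: "?I \<in> borel_measurable borel"
    by (intro borel_measurable_scaleR borel_measurable_indicator borel_measurable_continuous_onI
        continuous_intros) auto
  have "integral\<^sup>L lborel ?I = integral\<^sup>L (distr lborel borel (\<lambda>z. c * z)) ?I"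
    unfolding lborel_distr_rotation[OF c1 c2] ..
  also have "\<dots> = integral\<^sup>L lborel (\<lambda>z. ?I (c * z))"
    by (rule integral_distr[OF _ meas]) measurable
  also have "\<dots> = integral\<^sup>L lborel (\<lambda>z. \<i> * ?I z)"
    unfolding ind power_mult_distrib cn by (simp add: scaleR_conv_of_real mult_ac)
  also have "\<dots> = \<i> * integral\<^sup>L lborel ?I"
    by (rule integral_mult_right_zero)
  finally have "(1 - \<i>) * integral\<^sup>L lborel ?I = 0" by (simp add: algebra_simps)
  then show ?thesis
    unfolding set_lebesgue_integral_def by (auto simp: complex_eq_iff)
qed

section \<open>Mean value and submean value properties over disks\<close>

lemma set_integrable_ball_continuous:
  fixes f :: "complex \<Rightarrow> 'b::{banach, second_countable_topology}"
  assumes "continuous_on (cball w r) f"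
  shows "set_integrable lborel (ball w r) f"
proof -
  have "set_integrable lborel (cball w r) f"
    unfolding set_integrable_def by (intro borel_integrable_compact assms) auto
  then show ?thesis
    by (rule set_integrable_subset) auto
qed

lemma measure_lborel_complex_ball:
  assumes "0 \<le> r"
  shows "measure lborel (ball (w::complex) r) = pi * r\<^sup>2"
  using content_ball[of r w] assms by (simp add: unit_ball_vol_2)

lemma lborel_integral_translate:
  fixes f :: "complex \<Rightarrow> 'b::{banach, second_countable_topology}"
  assumes [measurable]: "f \<in> borel_measurable borel"
  shows "integral\<^sup>L lborel (\<lambda>z. f (w + z)) = integral\<^sup>L lborel f"
proof -
  have "integral\<^sup>L (distr lborel borel (\<lambda>z. w + z)) f = integral\<^sup>L lborel (\<lambda>z. f (w + z))"
    by (rule integral_distr) auto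
  then show ?thesis by (simp only: lborel_distr_plus)
qed

text \<open>The Taylor series at \<open>w\<close> is integrated term by term; every nonconstant
  power has integral 0 over the centered disk.\<close>

lemma area_mean_value:
  fixes f :: "complex \<Rightarrow> complex"
  assumes hol: "f holomorphic_on ball w R" and r: "0 < r" "r < R"
  shows "(LINT z:ball w r|lborel. f z) = of_real (pi * r\<^sup>2) * f w"
proof -
  define a where "a n = (deriv ^^ n) f w / fact n" for n
  have sums: "(\<lambda>n. a n * z ^ n) sums f (w + z)" if "z \<in> ball 0 R" for z
    using holomorphic_power_series[OF hol, of "w + z"] that by (simp add: a_def dist_norm)
  \<comment> \<open>Convergence at the larger radius \<open>s\<close> gives absolute summability at
    \<open>r\<close>, which dominates the exchange of sum and integral.\<close>
  obtain s where s: "r < s" "s < R" using r dense by blast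
  have summ: "summable (\<lambda>n. norm (a n * of_real r ^ n))"
  proof (rule powser_insidea)
    show "summable (\<lambda>n. a n * of_real s ^ n)"
      using sums[of "of_real s"] r s by (auto simp: sums_iff)
  qed (use r s in auto)
  let ?g = "\<lambda>n z. indicator (ball 0 r) z *\<^sub>R (a n * z ^ n)"
  have int: "integrable lborel (?g n)" for n
  proof -
    have "continuous_on (cball 0 r) (\<lambda>z. a n * z ^ n)" by (intro continuous_intros)
    from set_integrable_ball_continuous[OF this] show ?thesis unfolding set_integrable_def .
  qed
  have bnd: "norm (?g n z) \<le> indicator (ball 0 r) z * norm (a n * of_real r ^ n)" for n z
    using r by (auto simp: indicator_def norm_mult norm_power intro!: mult_left_mono power_mono)
  have sn: "summable (\<lambda>n. norm (?g n z))" for z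
  proof (rule summable_comparison_test_ev[OF _ summ])
    have "norm (norm (?g n z)) \<le> norm (a n * of_real r ^ n)" for n
    proof -
      have "indicator (ball 0 r) z * norm (a n * of_real r ^ n) \<le> norm (a n * of_real r ^ n)"
        by (simp add: indicator_def)
      then show ?thesis using bnd[where n = n and z = z] by simp
    qed
    then show "\<forall>\<^sub>F n in sequentially. norm (norm (?g n z)) \<le> norm (a n * of_real r ^ n)"
      by (intro always_eventually allI)
  qed
  have si: "summable (\<lambda>n. integral\<^sup>L lborel (\<lambda>z. norm (?g n z)))"
  proof (rule summable_comparison_test_ev)
    show "summable (\<lambda>n. (pi * r\<^sup>2) * norm (a n * of_real r ^ n))"
      using summ by (rule summable_mult)
    have "integral\<^sup>L lborel (\<lambda>z. norm (?g n z)) \<le> (pi * r\<^sup>2) * norm (a n * of_real r ^ n)" for n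
    proof -
      have "integral\<^sup>L lborel (\<lambda>z. norm (?g n z))
          \<le> integral\<^sup>L lborel (\<lambda>z. indicator (ball (0::complex) r) z * norm (a n * of_real r ^ n))"
        using bnd int by (intro integral_mono integrable_norm) (auto intro!: integrable_real_indicator emeasure_bounded_finite)
      also have "\<dots> = (pi * r\<^sup>2) * norm (a n * of_real r ^ n)"
        using r measure_lborel_complex_ball[of r 0] by simp
      finally show ?thesis .
    qed
    then show "\<forall>\<^sub>F n in sequentially. norm (integral\<^sup>L lborel (\<lambda>z. norm (?g n z)))
        \<le> (pi * r\<^sup>2) * norm (a n * of_real r ^ n)"
      by (auto intro!: always_eventually)
  qed
  have val: "integral\<^sup>L lborel (?g n) = (if n = 0 then of_real (pi * r\<^sup>2) * f w else 0)" for n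
  proof (cases "n = 0")
    case True
    have "integral\<^sup>L lborel (?g 0) = measure lborel (ball (0::complex) r) *\<^sub>R a 0"
    proof -
      have "integral\<^sup>L lborel (?g 0) = integral\<^sup>L lborel (indicator (ball (0::complex) r)) *\<^sub>R a 0"
        by (subst integral_scaleR_left[symmetric])
           (auto intro!: integrable_real_indicator emeasure_bounded_finite)
      then show ?thesis by simp
    qed
    then show ?thesis
      using True r measure_lborel_complex_ball[of r 0] by (simp add: a_def scaleR_conv_of_real)
  next
    case False
    have "integral\<^sup>L lborel (?g n) = a n * (LINT z:ball 0 r|lborel. z ^ n)"
      unfolding set_lebesgue_integral_def by (subst integral_mult_right_zero[symmetric]) (simp add: mult_ac)
    then show ?thesis using False set_integral_power_ball_0[of n r] by simp
  qed
  have "(\<lambda>n. integral\<^sup>L lborel (?g n)) sums integral\<^sup>L lborel (\<lambda>z. \<Sum>n. ?g n z)"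
    by (rule sums_integral[OF int _ si]) (use sn in auto)
  moreover have "(\<lambda>n. integral\<^sup>L lborel (?g n)) sums (of_real (pi * r\<^sup>2) * f w)"
    unfolding val using sums_If_finite[of "\<lambda>n. n = 0" "\<lambda>_. of_real (pi * r\<^sup>2) * f w"] by simp
  moreover have "(\<Sum>n. ?g n z) = indicator (ball 0 r) z *\<^sub>R f (w + z)" for z
  proof (cases "z \<in> ball 0 r")
    case True
    then have "z \<in> ball 0 R" using r by auto
    then show ?thesis using sums[of z] True by (simp add: sums_iff)
  qed simp
  ultimately have "integral\<^sup>L lborel (\<lambda>z. indicator (ball 0 r) z *\<^sub>R f (w + z)) = of_real (pi * r\<^sup>2) * f w"
    using sums_unique2 by fastforce
  moreover have "integral\<^sup>L lborel (\<lambda>z. indicator (ball w r) (w + z) *\<^sub>R f (w + z))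
      = integral\<^sup>L lborel (\<lambda>z. indicator (ball w r) z *\<^sub>R f z)"
  proof (rule lborel_integral_translate)
    have "continuous_on (cball w r) f"
      by (rule holomorphic_on_imp_continuous_on[OF holomorphic_on_subset[OF hol]]) (use r in auto)
    from set_integrable_ball_continuous[OF this]
    show "(\<lambda>z. indicator (ball w r) z *\<^sub>R f z) \<in> borel_measurable borel"
      unfolding set_integrable_def by auto
  qed
  ultimately show ?thesis
    unfolding set_lebesgue_integral_def by (simp add: indicator_def dist_norm)
qed

text \<open>Convexity. After scaling to \<open>y = x / a\<close> this is Young's inequality for the
  factors \<open>y\<close> and 1.\<close>

lemma powr_above_tangent:
  fixes a x p :: real
  assumes p: "1 < p" and a: "0 < a" and x: "0 \<le> x"
  shows "a powr p + p * a powr (p - 1) * (x - a) \<le> x powr p"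
proof -
  define y where "y = x / a"
  have y: "0 \<le> y" "x = a * y" using a x by (simp_all add: y_def)
  have "y * 1 \<le> y powr p / p + 1 powr (p / (p - 1)) / (p / (p - 1))"
    using p y by (intro Youngs_inequality) (auto simp: field_simps)
  then have "y \<le> (y powr p + (p - 1)) / p"
    by (simp add: add_divide_distrib)
  then have "p * y \<le> y powr p + (p - 1)"
    using p by (simp add: pos_le_divide_eq mult.commute)
  then have "1 + p * (y - 1) \<le> y powr p" by (simp add: algebra_simps)
  then have "a powr p * (1 + p * (y - 1)) \<le> a powr p * y powr p"
    by (intro mult_left_mono) auto
  moreover have "a powr p = a powr (p - 1) * a"
    using a powr_add[of a "p - 1" 1] by simp
  ultimately show ?thesis
    using a y by (simp add: powr_mult algebra_simps)
qed

text \<open>A tangent argument takes the place of subharmonicity: for a unimodular \<open>c\<close>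
  with \<open>c * f w = |f w|\<close>, the power \<open>|f z|^p\<close> dominates an affine function
  of \<open>Re (c * f z)\<close>, whose integral the mean value property computes exactly.\<close>

lemma area_submean_powr:
  fixes f :: "complex \<Rightarrow> complex"
  assumes hol: "f holomorphic_on ball w R" and r: "0 < r" "r < R" and p: "1 < p"
  shows "ennreal (pi * r\<^sup>2 * cmod (f w) powr p) \<le> (\<integral>\<^sup>+z\<in>ball w r. ennreal (cmod (f z) powr p) \<partial>lborel)"
proof (cases "f w = 0")
  case False
  define a where "a = cmod (f w)"
  have a: "0 < a" using False by (simp add: a_def)
  define c where "c = cnj (f w) / a"
  have c1: "cmod c = 1" using a by (simp add: c_def norm_divide a_def)
  have cf: "c * f w = a"
    using a complex_norm_square[of "f w"] by (simp add: c_def a_def power2_eq_square field_simps)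
  define L where "L z = a powr p + p * a powr (p - 1) * (Re (c * f z) - a)" for z
  have cont: "continuous_on (cball w r) f"
    by (rule holomorphic_on_imp_continuous_on[OF holomorphic_on_subset[OF hol]]) (use r in auto)
  have int_p: "set_integrable lborel (ball w r) (\<lambda>z. cmod (f z) powr p)"
    by (intro set_integrable_ball_continuous continuous_on_powr' continuous_intros cont) (use p in auto)
  have int_f: "set_integrable lborel (ball w r) (\<lambda>z. Re (c * f z))"
    by (intro set_integrable_ball_continuous continuous_intros cont)
  have int_1: "set_integrable lborel (ball w r) (\<lambda>z. k :: real)" for k
    by (intro set_integrable_ball_continuous continuous_intros)
  have L_eq: "L z = (a powr p - p * a powr (p - 1) * a) + p * a powr (p - 1) * Re (c * f z)" for z
    by (simp add: L_def algebra_simps)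
  have int_L: "set_integrable lborel (ball w r) L"
    unfolding L_eq[abs_def] by (intro set_integral_add(1) int_1 set_integrable_mult_right int_f)
  have mean: "(LINT z:ball w r|lborel. Re (c * f z)) = pi * r\<^sup>2 * a"
  proof -
    have I: "set_integrable lborel (ball w r) (\<lambda>z. c * f z)"
      by (intro set_integrable_ball_continuous continuous_intros cont)
    have "(LINT z:ball w r|lborel. c * f z) = c * (of_real (pi * r\<^sup>2) * f w)"
      using area_mean_value[OF hol r] by simp
    also have "\<dots> = of_real (pi * r\<^sup>2 * a)" using cf by (simp add: mult_ac)
    finally have "Re (LINT z:ball w r|lborel. c * f z) = pi * r\<^sup>2 * a" by simp
    moreover have "Re (LINT z:ball w r|lborel. c * f z) = (LINT z:ball w r|lborel. Re (c * f z))"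
      using integral_Re[OF I[unfolded set_integrable_def]]
      by (simp only: set_lebesgue_integral_def scaleR_complex.sel real_scaleR_def)
    ultimately show ?thesis by simp
  qed
  have const: "(LINT z:ball w r|lborel. k :: real) = pi * r\<^sup>2 * k" for k
    using r measure_lborel_complex_ball[of r w]
    by (simp add: set_lebesgue_integral_def)
  have "(LINT z:ball w r|lborel. L z)
      = pi * r\<^sup>2 * (a powr p - p * a powr (p - 1) * a) + p * a powr (p - 1) * (pi * r\<^sup>2 * a)"
    unfolding L_eq set_integral_add(2)[OF int_1 set_integrable_mult_right[OF int_f]]
      set_integral_mult_right mean const ..
  also have "\<dots> = pi * r\<^sup>2 * a powr p" by (simp add: algebra_simps)
  finally have "pi * r\<^sup>2 * a powr p = (LINT z:ball w r|lborel. L z)" ..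
  also have "\<dots> \<le> (LINT z:ball w r|lborel. cmod (f z) powr p)"
  proof (rule set_integral_mono[OF int_L int_p])
    fix z assume "z \<in> ball w r"
    have "Re (c * f z) \<le> cmod (f z)"
      using complex_Re_le_cmod[of "c * f z"] c1 by (simp add: norm_mult)
    then have "L z \<le> a powr p + p * a powr (p - 1) * (cmod (f z) - a)"
      unfolding L_def using p by (intro add_left_mono mult_left_mono) auto
    also have "\<dots> \<le> cmod (f z) powr p"
      using powr_above_tangent[OF p a] by simp
    finally show "L z \<le> cmod (f z) powr p" .
  qed
  finally have "ennreal (pi * r\<^sup>2 * a powr p) \<le> ennreal (LINT z:ball w r|lborel. cmod (f z) powr p)"
    by (rule ennreal_leI)
  also have "\<dots> = (\<integral>\<^sup>+z. ennreal (indicator (ball w r) z *\<^sub>R (cmod (f z) powr p)) \<partial>lborel)"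
    unfolding set_lebesgue_integral_def
    by (rule nn_integral_eq_integral[symmetric]) (use int_p in \<open>auto simp: set_integrable_def\<close>)
  also have "\<dots> = (\<integral>\<^sup>+z\<in>ball w r. ennreal (cmod (f z) powr p) \<partial>lborel)"
    by (intro nn_integral_cong) (auto simp: indicator_def)
  finally show ?thesis by (simp add: a_def)
qed simp

section \<open>The Schwarz--Pick inequality and finite Blaschke products\<close>

lemma moebius_norm_identity:
  fixes a z :: complex
  assumes "1 - cnj a * z \<noteq> 0"
  shows "1 - (cmod ((z - a) / (1 - cnj a * z)))\<^sup>2
    = (1 - (cmod a)\<^sup>2) * (1 - (cmod z)\<^sup>2) / (cmod (1 - cnj a * z))\<^sup>2"
proof -
  have "(cmod (1 - cnj a * z))\<^sup>2 - (cmod (z - a))\<^sup>2 = (1 - (cmod a)\<^sup>2) * (1 - (cmod z)\<^sup>2)"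
    unfolding cmod_power2 by (simp add: algebra_simps power2_eq_square)
  moreover have "1 - (cmod ((z - a) / (1 - cnj a * z)))\<^sup>2
      = ((cmod (1 - cnj a * z))\<^sup>2 - (cmod (z - a))\<^sup>2) / (cmod (1 - cnj a * z))\<^sup>2"
    using assms unfolding norm_divide power_divide by (simp add: diff_divide_distrib)
  ultimately show ?thesis by simp
qed

lemma disk_mult_cnj_ne_1:
  assumes "cmod a < 1" "cmod z < 1"
  shows "1 - cnj a * z \<noteq> 0"
proof
  assume "1 - cnj a * z = 0"
  then have "cmod a * cmod z = 1" by (metis complex_mod_cnj eq_iff_diff_eq_0 norm_mult norm_one)
  moreover have "cmod a * cmod z < 1 * 1" using assms by (intro mult_strict_mono') auto
  ultimately show False by simp
qed

text \<open>Disk automorphisms moving \<open>a\<close> and \<open>f a\<close> to 0 reduce this to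
  the Schwarz lemma. Both sides are 1 minus a squared pseudo-hyperbolic distance, the form in which
  boundary distances appear as factors.\<close>

lemma schwarz_pick:
  fixes f :: "complex \<Rightarrow> complex"
  assumes hol: "f holomorphic_on ball 0 1" and self: "f ` ball 0 1 \<subseteq> ball 0 1"
    and a: "cmod a < 1" and z: "cmod z < 1"
  shows "(1 - (cmod a)\<^sup>2) * (1 - (cmod z)\<^sup>2) / (cmod (1 - cnj a * z))\<^sup>2
    \<le> (1 - (cmod (f a))\<^sup>2) * (1 - (cmod (f z))\<^sup>2) / (cmod (1 - cnj (f a) * f z))\<^sup>2"
proof -
  define F where "F = (Moebius_function 0 (f a) \<circ> f) \<circ> Moebius_function 0 (-a)"
  have fa: "cmod (f w) < 1" if "cmod w < 1" for w using self that by (auto simp: image_subset_iff)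
  have M: "Moebius_function 0 c holomorphic_on ball 0 1" "Moebius_function 0 c ` ball 0 1 \<subseteq> ball 0 1"
    if "cmod c < 1" for c
    using that Moebius_function_holomorphic Moebius_function_norm_lt_1 by auto
  have holF: "F holomorphic_on ball 0 1"
    unfolding F_def
  proof (rule holomorphic_on_compose_gen)
    show "Moebius_function 0 (f a) \<circ> f holomorphic_on ball 0 1"
      by (rule holomorphic_on_compose_gen[OF hol M(1)[OF fa[OF a]] self])
  qed (use a in \<open>simp_all add: M\<close>)
  have normF: "cmod (F w) < 1" if "cmod w < 1" for w
    unfolding F_def comp_apply
    by (rule Moebius_function_norm_lt_1[OF fa[OF a] fa[OF Moebius_function_norm_lt_1[OF _ that]]])
       (use a in simp)
  have F0: "F 0 = 0"
    unfolding F_def by (simp add: Moebius_function_simple)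
  define m where "m = Moebius_function 0 a z"
  have m1: "cmod m < 1" unfolding m_def using a z by (simp add: Moebius_function_norm_lt_1)
  have inv: "Moebius_function 0 (-a) m = z"
    unfolding m_def using Moebius_function_compose[of "-a" a z] a z by simp
  have Fm: "F m = (f z - f a) / (1 - cnj (f a) * f z)"
    unfolding F_def comp_def inv by (simp add: Moebius_function_simple)
  have "cmod (F m) \<le> cmod m"
    by (rule Schwarz_Lemma(1)[OF holF F0 normF m1])
  then have "(cmod (F m))\<^sup>2 \<le> (cmod m)\<^sup>2" by (simp add: power_mono)
  moreover note moebius_norm_identity[OF disk_mult_cnj_ne_1[OF a z]]
    moebius_norm_identity[OF disk_mult_cnj_ne_1[OF fa[OF a] fa[OF z]]]
  moreover have "m = (z - a) / (1 - cnj a * z)" by (simp add: m_def Moebius_function_simple)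
  ultimately show ?thesis
    unfolding Fm by (simp only:)
qed

section \<open>Blaschke factors and the splitting off of zeros\<close>

definition blaschke_factor :: "complex \<Rightarrow> complex \<Rightarrow> complex" where
  "blaschke_factor a z = (z - a) / (1 - cnj a * z)"

lemma norm_blaschke_factor_lt_1:
  assumes "cmod a < 1" "cmod z < 1"
  shows "cmod (blaschke_factor a z) < 1"
  using Moebius_function_norm_lt_1[OF assms, of 0] by (simp add: blaschke_factor_def Moebius_function_simple)

text \<open>Points with \<open>|a| \<le> r\<close> stay within a bounded hyperbolic distance of the
  point \<open>r\<close>. The bound is below 1 and uniform in \<open>a\<close>, so it can be used to
  count zeros.\<close>

lemma norm_blaschke_factor_le:
  assumes a: "cmod a < 1" "cmod a \<le> r" and r: "0 < r" "r < 1"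
  shows "cmod (blaschke_factor a (of_real r)) \<le> sqrt (1 - (1 - r\<^sup>2)\<^sup>2 / 4)"
proof (rule real_le_rsqrt)
  have ne: "1 - cnj a * of_real r \<noteq> 0" using disk_mult_cnj_ne_1[of a "of_real r"] a r by simp
  have "cmod (1 - cnj a * of_real r) \<le> 1 + cmod a * r"
    using norm_triangle_ineq4[of 1 "cnj a * of_real r"] r by (simp add: norm_mult)
  also have "\<dots> \<le> 2" using mult_mono[of "cmod a" 1 r 1] a r by simp
  finally have "(cmod (1 - cnj a * of_real r))\<^sup>2 \<le> 2\<^sup>2" by (intro power_mono) auto
  then have d: "(cmod (1 - cnj a * of_real r))\<^sup>2 \<le> 4" by simp
  have a2: "(cmod a)\<^sup>2 \<le> r\<^sup>2" using a by (intro power_mono) auto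
  have r2: "r\<^sup>2 < 1" using r by (simp add: power_less_one_iff)
  have "(1 - r\<^sup>2)\<^sup>2 / 4 \<le> (1 - (cmod a)\<^sup>2) * (1 - r\<^sup>2) / (cmod (1 - cnj a * of_real r))\<^sup>2"
    unfolding power2_eq_square[of "1 - r\<^sup>2"] using d a2 r2 ne
    by (intro frac_le mult_right_mono mult_nonneg_nonneg) auto
  then show "(cmod (blaschke_factor a (of_real r)))\<^sup>2 \<le> 1 - (1 - r\<^sup>2)\<^sup>2 / 4"
    using moebius_norm_identity[OF ne] r unfolding blaschke_factor_def norm_of_real power2_abs
    by linarith
qed

text \<open>Since \<open>g a = 0\<close>, Schwarz--Pick amounts to
  \<open>|g| \<le> |blaschke_factor a|\<close>. So the quotient is bounded by 1 off
  \<open>a\<close>, and at \<open>a\<close> by continuity.\<close>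

lemma divide_blaschke_factor:
  fixes g :: "complex \<Rightarrow> complex"
  assumes hol: "g holomorphic_on ball 0 1" and le1: "\<And>z. cmod z < 1 \<Longrightarrow> cmod (g z) \<le> 1"
    and a: "cmod a < 1" "g a = 0"
  obtains k where "k holomorphic_on ball 0 1" "\<And>z. cmod z < 1 \<Longrightarrow> cmod (k z) \<le> 1"
    "\<And>z. cmod z < 1 \<Longrightarrow> g z = blaschke_factor a z * k z"
proof -
  \<comment> \<open>Schwarz--Pick wants a map into the open disk; a value of modulus 1 would make
    \<open>g\<close> constant, against the zero at \<open>a\<close>.\<close>
  have lt1: "cmod (g z) < 1" if z: "cmod z < 1" for z
  proof (rule ccontr)
    assume "\<not> cmod (g z) < 1"
    then have eq: "cmod (g z) = 1" using le1[OF z] by simp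
    have "g constant_on ball 0 1"
      by (rule maximum_modulus_principle[OF hol _ _ open_ball order_refl, of z])
         (use le1 eq z in auto)
    then have "g z = g a" using a z unfolding constant_on_def by force
    with eq a show False by simp
  qed
  define q where "q z = (if z = a then deriv g a else (g z - g a) / (z - a))" for z
  define k where "k z = q z * (1 - cnj a * z)" for z
  have holk: "k holomorphic_on ball 0 1"
    unfolding k_def q_def by (intro holomorphic_intros pole_lemma_open hol) auto
  have fact: "g z = blaschke_factor a z * k z" if "cmod z < 1" for z
    using disk_mult_cnj_ne_1[OF a(1) that] a by (auto simp: blaschke_factor_def k_def q_def)
  have off: "cmod (k z) \<le> 1" if z: "cmod z < 1" "z \<noteq> a" for z
  proof -
    have "1 - (cmod (blaschke_factor a z))\<^sup>2 \<le> 1 - (cmod (g z))\<^sup>2"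
    proof -
      have "g ` ball 0 1 \<subseteq> ball 0 1" using lt1 by auto
      from schwarz_pick[OF hol this a(1) z(1)] show ?thesis
        using a moebius_norm_identity[OF disk_mult_cnj_ne_1[OF a(1) z(1)]]
        by (simp add: blaschke_factor_def)
    qed
    then have "(cmod (g z))\<^sup>2 \<le> (cmod (blaschke_factor a z))\<^sup>2" by linarith
    then have "cmod (g z) \<le> cmod (blaschke_factor a z)"
      by (rule power2_le_imp_le) (rule norm_ge_zero)
    then have "cmod (blaschke_factor a z) * cmod (k z) \<le> cmod (blaschke_factor a z) * 1"
      unfolding fact[OF z(1)] norm_mult by (simp only: mult_1_right)
    moreover have "0 < cmod (blaschke_factor a z)"
      using z disk_mult_cnj_ne_1[OF a(1) z(1)] by (simp add: blaschke_factor_def)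
    ultimately show ?thesis by (simp only: mult_le_cancel_left_pos)
  qed
  have at_a: "cmod (k a) \<le> 1"
  proof (rule tendsto_upperbound)
    have "isCont k a"
      using holomorphic_on_imp_continuous_on[OF holk] a by (simp add: continuous_on_eq_continuous_at)
    then show "((\<lambda>z. cmod (k z)) \<longlongrightarrow> cmod (k a)) (at a)"
      unfolding isCont_def by (rule tendsto_norm)
    have "\<forall>\<^sub>F z in at a. z \<in> ball 0 1 - {a}"
      using a by (intro eventually_at_in_open) auto
    then show "\<forall>\<^sub>F z in at a. cmod (k z) \<le> 1"
      by eventually_elim (use off in auto)
  qed simp
  show ?thesis
    using that[OF holk _ fact] off at_a by blast
qed

lemma finite_blaschke_product_mult:
  assumes "finite_blaschke_product k" "cmod a < 1"
    and g: "\<And>z. cmod z < 1 \<Longrightarrow> g z = blaschke_factor a z * k z"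
  shows "finite_blaschke_product g"
proof -
  from assms(1) obtain n :: nat and b c where b: "cmod c = 1" "\<forall>j<n. b j \<in> unit_disk"
    "\<forall>z\<in>unit_disk. k z = c * (\<Prod>j<n. (z - b j) / (1 - cnj (b j) * z))"
    unfolding finite_blaschke_product_def by blast
  have "(\<Prod>j<Suc n. (z - (b(n := a)) j) / (1 - cnj ((b(n := a)) j) * z))
      = (\<Prod>j<n. (z - b j) / (1 - cnj (b j) * z)) * blaschke_factor a z" for z
    by (simp add: blaschke_factor_def)
  then show ?thesis
    unfolding finite_blaschke_product_def using b g assms(2)
    by (intro exI[of _ "Suc n"] exI[of _ "b(n := a)"] exI[of _ c]) (auto simp: less_Suc_eq)
qed

text \<open>The maximum principle for \<open>1 / g\<close> on a disk whose boundary circle lies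
  where \<open>c < |g|\<close> gives \<open>c \<le> |g|\<close> inside. Letting \<open>c\<close>
  tend to 1 makes \<open>g\<close> a unimodular constant, the product without factors.\<close>

lemma zero_free_proper_imp_unimodular:
  fixes g :: "complex \<Rightarrow> complex"
  assumes hol: "g holomorphic_on ball 0 1" and le1: "\<And>z. cmod z < 1 \<Longrightarrow> cmod (g z) \<le> 1"
    and proper: "\<And>c. c < 1 \<Longrightarrow> \<exists>s<1. \<forall>z. s < cmod z \<and> cmod z < 1 \<longrightarrow> c < cmod (g z)"
    and nz: "\<And>z. cmod z < 1 \<Longrightarrow> g z \<noteq> 0"
  shows "finite_blaschke_product g"
proof -
  have ge: "c \<le> cmod (g z)" if c: "0 < c" "c < 1" and z: "cmod z < 1" for c z
  proof -
    obtain s where s: "s < 1" "\<And>z. s < cmod z \<and> cmod z < 1 \<Longrightarrow> c < cmod (g z)"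
      using proper[OF c(2)] by blast
    obtain t where t: "max s (cmod z) < t" "t < 1" using dense[of "max s (cmod z)" 1] s z by auto
    have t0: "0 < t" using t norm_ge_zero[of z] by linarith
    have sub: "cball 0 t \<subseteq> (ball 0 1 :: complex set)" using t by auto
    have holi: "(\<lambda>z. inverse (g z)) holomorphic_on ball 0 1"
      using hol nz by (intro holomorphic_intros) auto
    have "cmod (inverse (g z)) \<le> inverse c"
    proof (rule maximum_modulus_frontier[of "\<lambda>z. inverse (g z)" "cball 0 t"])
      show "(\<lambda>z. inverse (g z)) holomorphic_on interior (cball 0 t)"
        by (rule holomorphic_on_subset[OF holi]) (use sub interior_subset in blast)
      show "continuous_on (closure (cball 0 t)) (\<lambda>z. inverse (g z))"
        using holomorphic_on_imp_continuous_on[OF holomorphic_on_subset[OF holi sub]] by simp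
      fix w :: complex assume "w \<in> frontier (cball 0 t)"
      then have "cmod w = t" using t0 by simp
      then show "cmod (inverse (g w)) \<le> inverse c"
        using s(2)[of w] t c by (auto simp: norm_inverse intro!: le_imp_inverse_le)
    qed (use t in auto)
    then show ?thesis
      using c nz[OF z] by (simp add: norm_inverse inverse_le_iff_le)
  qed
  have one: "cmod (g z) = 1" if "cmod z < 1" for z
  proof (rule antisym[OF le1[OF that]])
    show "1 \<le> cmod (g z)"
      by (rule field_le_mult_one_interval) (use ge that in auto)
  qed
  have "g constant_on ball 0 1"
    by (rule maximum_modulus_principle[OF hol _ _ open_ball order_refl, of 0]) (use one in auto)
  then obtain c where "\<forall>z\<in>ball 0 1. g z = c" unfolding constant_on_def by blast
  moreover from this one[of 0] have "cmod c = 1" by simp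
  ultimately show ?thesis
    unfolding finite_blaschke_product_def by (intro exI[of _ 0] exI[of _ c]) auto
qed

text \<open>
  Each Blaschke factor split off multiplies the value at the point \<open>r\<close> by at least \<open>1/q\<close>, so only
  finitely many factors can be split off.
\<close>

lemma proper_imp_finite_blaschke_product:
  fixes g :: "complex \<Rightarrow> complex"
  assumes "g holomorphic_on ball 0 1" and "\<And>z. cmod z < 1 \<Longrightarrow> cmod (g z) \<le> 1"
    and "\<And>c. c < 1 \<Longrightarrow> \<exists>s<1. \<forall>z. s < cmod z \<and> cmod z < 1 \<longrightarrow> c < cmod (g z)"
  shows "finite_blaschke_product g"
proof -
  obtain s where s: "s < 1" "\<And>z. s < cmod z \<and> cmod z < 1 \<Longrightarrow> 1 / 2 < cmod (g z)"
    using assms(3)[of "1 / 2"] by auto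
  \<comment> \<open>All zeros lie in \<open>|z| < r\<close>. Dividing by a Blaschke factor does not
    decrease \<open>|g|\<close>, so the same \<open>r\<close> serves every quotient.\<close>
  obtain r where r: "max s 0 < r" "r < 1" using dense[of "max s 0" 1] s by auto
  define q where "q = sqrt (1 - (1 - r\<^sup>2)\<^sup>2 / 4)"
  have "r\<^sup>2 < 1" "0 \<le> r\<^sup>2" using r by (auto simp: power_less_one_iff)
  then have "0 < (1 - r\<^sup>2)\<^sup>2" "(1 - r\<^sup>2)\<^sup>2 \<le> 1" by (auto intro: power_le_one)
  then have q: "0 < q" "q < 1" by (auto simp: q_def)
  have large: "1 / 2 < cmod (g z)" if "r \<le> cmod z" "cmod z < 1" for z
    using s(2)[of z] that r by simp
  \<comment> \<open>\<open>n\<close> bounds the divisions still possible: each turns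
    \<open>q ^ Suc n\<close> into \<open>q ^ n\<close> in the last premise, and at
    \<open>n = 0\<close> that premise contradicts \<open>|g| \<le> 1\<close>.\<close>
  have ind: "finite_blaschke_product g"
    if "g holomorphic_on ball 0 1" "\<And>z. cmod z < 1 \<Longrightarrow> cmod (g z) \<le> 1"
      "\<And>c. c < 1 \<Longrightarrow> \<exists>s<1. \<forall>z. s < cmod z \<and> cmod z < 1 \<longrightarrow> c < cmod (g z)"
      "\<And>z. \<lbrakk>r \<le> cmod z; cmod z < 1\<rbrakk> \<Longrightarrow> 1 / 2 < cmod (g z)"
      "q ^ n < cmod (g (of_real r))" for n g
    using that
  proof (induction n arbitrary: g)
    case 0
    have "cmod (g (of_real r)) \<le> 1" using r by (intro 0(2)) simp
    with 0(5) show ?case by simp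
  next
    case (Suc n)
    show ?case
    proof (cases "\<exists>a. cmod a < 1 \<and> g a = 0")
      case False
      then show ?thesis using zero_free_proper_imp_unimodular[OF Suc.prems(1-3)] by blast
    next
      case True
      then obtain a where a: "cmod a < 1" "g a = 0" by blast
      have ar: "cmod a \<le> r" using Suc.prems(4)[of a] a by force
      obtain k where k: "k holomorphic_on ball 0 1" "\<And>z. cmod z < 1 \<Longrightarrow> cmod (k z) \<le> 1"
        "\<And>z. cmod z < 1 \<Longrightarrow> g z = blaschke_factor a z * k z"
        using divide_blaschke_factor[OF Suc.prems(1,2) a] by blast
      have gk: "cmod (g z) \<le> cmod (k z)" if "cmod z < 1" for z
        unfolding k(3)[OF that] norm_mult
        using norm_blaschke_factor_lt_1[OF a(1) that] by (simp add: mult_left_le_one_le)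
      have "finite_blaschke_product k"
      proof (rule Suc.IH[OF k(1,2)])
        fix c :: real assume "c < 1"
        then show "\<exists>s<1. \<forall>z. s < cmod z \<and> cmod z < 1 \<longrightarrow> c < cmod (k z)"
          using Suc.prems(3)[of c] gk by (meson less_le_trans)
      next
        fix z :: complex assume "r \<le> cmod z" "cmod z < 1"
        then show "1 / 2 < cmod (k z)" using Suc.prems(4)[of z] gk[of z] by linarith
      next
        have "q * q ^ n < cmod (blaschke_factor a (of_real r)) * cmod (k (of_real r))"
          using Suc.prems(5) k(3)[of "of_real r"] r by (simp add: norm_mult)
        also have "\<dots> \<le> q * cmod (k (of_real r))"
          using norm_blaschke_factor_le[OF a(1) ar] r unfolding q_def by (intro mult_right_mono) auto
        finally show "q ^ n < cmod (k (of_real r))" using q by simp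
      qed
      then show ?thesis using finite_blaschke_product_mult[OF _ a(1) k(3)] by blast
    qed
  qed
  obtain n where "q ^ n < 1 / 2" using real_arch_pow_inv[of "1 / 2" q] q by auto
  then have "q ^ n < cmod (g (of_real r))" using large[of "of_real r"] r by simp
  from ind[OF assms large this] show ?thesis by blast
qed

section \<open>Tails of regular weights\<close>

text \<open>Integrated form of \<open>h / (C (1 - r)) \<le> - h' \<le> C h / (1 - r)\<close>, which
  is regularity when \<open>h\<close> is the tail of a weight. Differences stand in for the
  derivative because the weight is merely integrable; the integrands are replaced by extreme values
  on \<open>[x, y]\<close>.\<close>

locale regular_tail =
  fixes h :: "real \<Rightarrow> real" and C :: real
  assumes C_pos: "0 < C"
    and pos: "\<lbrakk>0 \<le> x; x < 1\<rbrakk> \<Longrightarrow> 0 < h x"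
    and antimono: "\<lbrakk>0 \<le> x; x \<le> y; y < 1\<rbrakk> \<Longrightarrow> h y \<le> h x"
    and diff_upper: "\<lbrakk>0 \<le> x; x \<le> y; y < 1\<rbrakk> \<Longrightarrow> h x - h y \<le> C * h x * ((y - x) / (1 - y))"
    and diff_lower: "\<lbrakk>0 \<le> x; x \<le> y; y < 1\<rbrakk> \<Longrightarrow> h y * ((y - x) / (1 - x)) / C \<le> h x - h y"
begin

text \<open>Each shrinking of the boundary distance by the factor \<open>1 + 1 / (2 * C)\<close>
  costs at most a factor 2 in \<open>h\<close>, and \<open>n\<close> of them lead from
  \<open>1 - x\<close> to at most \<open>1 - s\<close>.\<close>

lemma doubling_power:
  assumes "0 \<le> x" "x < 1" "0 \<le> s" "s < 1" "1 - x \<le> (1 + 1 / (2 * C)) ^ n * (1 - s)"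
  shows "h x \<le> 2 ^ n * h s"
  using assms(1,2,5)
proof (induction n arbitrary: x)
  case 0
  then show ?case using antimono[of s x] assms(3) by simp
next
  case (Suc n)
  \<comment> \<open>Chosen so that \<open>C * (l - 1) = 1 / 2\<close>, which makes the loss in
    \<open>diff_upper\<close> half of \<open>h x\<close>.\<close>
  define l where "l = 1 + 1 / (2 * C)"
  have l: "1 < l" using C_pos by (simp add: l_def)
  define y where "y = 1 - (1 - x) / l"
  have y1: "1 - y = (1 - x) / l" by (simp add: y_def)
  have "(1 - x) * 1 \<le> (1 - x) * l" using l Suc.prems by (intro mult_left_mono) auto
  then have "(1 - x) / l \<le> 1 - x" using l by (simp add: pos_divide_le_eq)
  then have xy: "x \<le> y" by (simp add: y_def)
  have y: "y < 1" using l Suc.prems by (simp add: y_def)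
  have "(y - x) / (1 - y) = l - 1"
    using l Suc.prems unfolding y1 by (simp add: y_def field_simps)
  then have "C * h x * ((y - x) / (1 - y)) = h x / 2"
    using C_pos by (simp add: l_def)
  with diff_upper[OF Suc.prems(1) xy y] have hx: "h x \<le> 2 * h y" by simp
  have "h y \<le> 2 ^ n * h s"
  proof (rule Suc.IH)
    show "1 - y \<le> (1 + 1 / (2 * C)) ^ n * (1 - s)"
      using Suc.prems(3) l unfolding y1 l_def[symmetric] by (simp add: pos_divide_le_eq mult_ac)
  qed (use xy y Suc.prems in auto)
  with hx show ?case by simp
qed

lemma doubling:
  fixes K :: real
  obtains D where "0 < D"
    "\<And>x s. \<lbrakk>0 \<le> x; x < 1; 0 \<le> s; s < 1; 1 - x \<le> K * (1 - s)\<rbrakk> \<Longrightarrow> h x \<le> D * h s"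
proof -
  have "1 < 1 + 1 / (2 * C)" using C_pos by simp
  from real_arch_pow[OF this] obtain n where n: "K < (1 + 1 / (2 * C)) ^ n" by blast
  show ?thesis
  proof (rule that[of "2 ^ n"])
    fix x s :: real
    assume a: "0 \<le> x" "x < 1" "0 \<le> s" "s < 1" "1 - x \<le> K * (1 - s)"
    have "K * (1 - s) \<le> (1 + 1 / (2 * C)) ^ n * (1 - s)"
      using n a by (intro mult_right_mono) auto
    with a have "1 - x \<le> (1 + 1 / (2 * C)) ^ n * (1 - s)" by linarith
    then show "h x \<le> 2 ^ n * h s" using doubling_power a by blast
  qed simp
qed

text \<open>At the midpoint \<open>y\<close> of \<open>x\<close> and 1, \<open>diff_lower\<close>
  becomes \<open>h y * (1 + 1 / (2 * C)) \<le> h x\<close>; this is the factor gained per halving of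
  the boundary distance.\<close>

definition decay_rate :: real where
  "decay_rate = 1 / (1 + 1 / (2 * C))"

lemma decay_rate: "0 < decay_rate" "decay_rate < 1"
  using C_pos by (simp_all add: decay_rate_def add_pos_pos)

lemma decay:
  assumes "0 \<le> x" "x < 1"
  shows "h (1 - (1 - x) / 2 ^ k) \<le> decay_rate ^ k * h x"
proof (induction k)
  case (Suc k)
  define y where "y = 1 - (1 - x) / 2 ^ k"
  have "1 - x \<le> (1 - x) * 2 ^ k"
    using assms mult_left_mono[of 1 "2 ^ k" "1 - x"] by simp
  then have "(1 - x) / 2 ^ k \<le> 1 - x" by (simp add: pos_divide_le_eq)
  moreover have "0 < (1 - x) / 2 ^ k" using assms by simp
  ultimately have y: "0 \<le> y" "y < 1"
    using assms by (auto simp only: y_def)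
  have eq: "1 - (1 - x) / 2 ^ Suc k = (1 + y) / 2"
    by (simp add: y_def field_simps)
  have half: "((1 + y) / 2 - y) / (1 - y) = 1 / 2"
    using y by (simp add: field_simps)
  have "h ((1 + y) / 2) * (1 / 2) / C \<le> h y - h ((1 + y) / 2)"
    using diff_lower[of y "(1 + y) / 2"] y unfolding half by simp
  then have "h ((1 + y) / 2) * (1 + 1 / (2 * C)) \<le> h y"
    by (simp add: field_simps)
  then have "h ((1 + y) / 2) \<le> decay_rate * h y"
    using C_pos by (simp add: decay_rate_def pos_le_divide_eq add_pos_pos)
  also have "\<dots> \<le> decay_rate * (decay_rate ^ k * h x)"
    using Suc decay_rate unfolding y_def by (intro mult_left_mono) auto
  finally show ?case unfolding eq by simp
qed simp

end

text \<open>Half of the critical exponent \<open>- log 2 q\<close> leaves room for strictness. The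
  cap 1/2 serves the multiplier, whose exponent \<open>\<delta> / p\<close> must not exceed
  1/2.\<close>

lemma (in regular_tail) ex_decay_exponent:
  obtains \<delta> where "0 < \<delta>" "\<delta> \<le> 1 / 2" "decay_rate * 2 powr \<delta> < 1"
proof (rule that)
  define q where "q = decay_rate"
  have q: "0 < q" "q < 1" using decay_rate by (auto simp: q_def)
  have l: "0 < - log 2 q" using q by simp
  show "0 < min (1 / 2) (- log 2 q / 2)" "min (1 / 2) (- log 2 q / 2) \<le> 1 / 2" using l by auto
  have "q * 2 powr (min (1 / 2) (- log 2 q / 2)) \<le> q * 2 powr (- log 2 q / 2)"
    using q by (intro mult_left_mono powr_mono) auto
  also have "\<dots> < q * 2 powr (- log 2 q)"
    using q l by (intro mult_strict_left_mono powr_less_mono) auto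
  also have "\<dots> = 1" using q by (simp add: powr_minus)
  finally show "decay_rate * 2 powr (min (1 / 2) (- log 2 q / 2)) < 1" by (simp add: q_def)
qed

text \<open>Integrating the pointwise bounds on \<open>\<omega>\<close> gives the difference
  inequalities. Clamping the argument to \<open>[0, 1]\<close> gives a monotone, hence Borel,
  function on the whole line.\<close>

lemma regular_weight_tail:
  assumes "regular_weight \<omega>"
  obtains C where "regular_tail (\<lambda>r. tail_integral \<omega> (max 0 (min r 1))) C"
    "\<And>r. \<lbrakk>0 < r; r < 1\<rbrakk> \<Longrightarrow> \<omega> (of_real r) \<le> C * (tail_integral \<omega> r / (1 - r))"
    "\<And>r. \<lbrakk>0 < r; r < 1\<rbrakk> \<Longrightarrow> tail_integral \<omega> r / (1 - r) \<le> C * \<omega> (of_real r)"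
    "(\<lambda>r. tail_integral \<omega> (max 0 (min r 1))) \<in> borel_measurable borel"
proof -
  define T where "T = tail_integral \<omega>"
  from assms obtain C where C: "0 < C"
    "\<And>r. \<lbrakk>0 < r; r < 1\<rbrakk> \<Longrightarrow> 1 / C < tail_ratio \<omega> r \<and> tail_ratio \<omega> r < C"
    unfolding regular_weight_def greaterThanLessThan_iff Ball_def by blast
  have w: "\<forall>z\<in>unit_disk. 0 < \<omega> z"
    and int: "set_integrable lebesgue {0<..<1} (\<lambda>s. \<omega> (of_real s))"
    using assms unfolding regular_weight_def weight_def by blast+
  have w0: "0 < \<omega> (of_real r)" if "0 < r" "r < 1" for r
    using bspec[OF w, of "of_real r"] that by simp
  have T_pos: "0 < T r" and w_le: "\<omega> (of_real r) \<le> C * (T r / (1 - r))"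
    and w_ge: "T r / (1 - r) \<le> C * \<omega> (of_real r)" if r: "0 < r" "r < 1" for r
  proof -
    let ?w = "\<omega> (of_real r)"
    have p: "0 < (1 - r) * ?w" using w0[OF r] r by simp
    have a: "1 / C < T r / ((1 - r) * ?w)" "T r / ((1 - r) * ?w) < C"
      using C(2)[OF r] by (auto simp: tail_ratio_def T_def)
    have "0 < T r / ((1 - r) * ?w)" using a(1) C(1) by (meson less_trans zero_less_divide_1_iff)
    then show "0 < T r" using p by (simp only: zero_less_divide_iff) auto
    have "(1 - r) * ?w < C * T r"
      using a(1) p C(1) by (simp add: divide_simps mult.commute)
    then show "?w \<le> C * (T r / (1 - r))" using r by (simp add: pos_le_divide_eq mult.commute)
    have "T r < C * ((1 - r) * ?w)" using a(2) p by (simp add: pos_divide_less_eq)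
    then show "T r / (1 - r) \<le> C * ?w" using r by (simp add: pos_divide_le_eq mult_ac)
  qed
  have sub: "set_integrable lebesgue A (\<lambda>s. \<omega> (of_real s))"
    if "A \<subseteq> {0<..<1}" "A \<in> sets lebesgue" for A
    using set_integrable_subset[OF int] that by auto
  have diff: "T x - T y = (LINT s:{x<..y}|lebesgue. \<omega> (of_real s))" if "0 \<le> x" "x \<le> y" "y < 1" for x y
  proof -
    have "{x<..<1} = {x<..y} \<union> {y<..<1}" using that by auto
    then have "T x = (LINT s:{x<..y} \<union> {y<..<1}|lebesgue. \<omega> (of_real s))"
      by (simp add: T_def tail_integral_def)
    also have "\<dots> = (LINT s:{x<..y}|lebesgue. \<omega> (of_real s)) + T y"
      unfolding T_def tail_integral_def by (rule set_integral_Un) (use that in \<open>auto intro!: sub\<close>)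
    finally show ?thesis by simp
  qed
  have const: "(LINT s:{x<..y}|lebesgue. k) = k * (y - x)" if "x \<le> y" for x y k :: real
    using that by (simp add: set_lebesgue_integral_def)
  have intc: "set_integrable lebesgue {x<..y} (\<lambda>_. k)" for x y k :: real
  proof -
    have "{x<..y} \<in> lmeasurable" by (rule bounded_set_imp_lmeasurable) auto
    then show ?thesis
      unfolding set_integrable_def
      by (intro integrable_scaleR_left integrable_real_indicator) (auto simp: fmeasurable_def)
  qed
  have diff_nonneg: "T y \<le> T x" if "0 \<le> x" "x \<le> y" "y < 1" for x y
  proof -
    have "0 \<le> (LINT s:{x<..y}|lebesgue. \<omega> (of_real s))"
      unfolding set_lebesgue_integral_def
      by (rule Bochner_Integration.integral_nonneg) (use that w0 in \<open>auto simp: indicator_def less_imp_le\<close>)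
    then show ?thesis using diff[OF that] by simp
  qed
  \<comment> \<open>Regularity says nothing at radius 0; positivity there comes from
    monotonicity.\<close>
  have T_pos': "0 < T x" if "0 \<le> x" "x < 1" for x
  proof (cases "x = 0")
    case True
    then show ?thesis using T_pos[of "1 / 2"] diff_nonneg[of 0 "1 / 2"] by simp
  qed (use that T_pos in auto)
  have T_upper: "T x - T y \<le> C * T x * ((y - x) / (1 - y))" if xy: "0 \<le> x" "x \<le> y" "y < 1" for x y
  proof -
    have "T x - T y \<le> (LINT s:{x<..y}|lebesgue. C * (T x / (1 - y)))"
      unfolding diff[OF xy]
    proof (rule set_integral_mono[OF sub intc])
      fix s assume s: "s \<in> {x<..y}"
      then have s1: "0 < s" "s < 1" using xy by auto
      have "\<omega> (of_real s) \<le> C * (T s / (1 - s))" by (rule w_le[OF s1])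
      also have "\<dots> \<le> C * (T x / (1 - y))"
        using C(1) diff_nonneg[of x s] T_pos'[of x] s s1 xy by (intro mult_left_mono frac_le) auto
      finally show "\<omega> (of_real s) \<le> C * (T x / (1 - y))" .
    qed (use xy in auto)
    then show ?thesis using const[OF xy(2)] by (simp add: mult_ac)
  qed
  have T_lower: "T y * ((y - x) / (1 - x)) / C \<le> T x - T y" if xy: "0 \<le> x" "x \<le> y" "y < 1" for x y
  proof -
    have "(LINT s:{x<..y}|lebesgue. T y / (1 - x) / C) \<le> T x - T y"
      unfolding diff[OF xy]
    proof (rule set_integral_mono[OF intc sub])
      fix s assume s: "s \<in> {x<..y}"
      then have s1: "0 < s" "s < 1" using xy by auto
      have "T y / (1 - x) \<le> T s / (1 - s)"
        using diff_nonneg[of s y] T_pos[OF s1] s s1 xy by (intro frac_le) auto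
      also have "\<dots> \<le> C * \<omega> (of_real s)" by (rule w_ge[OF s1])
      finally show "T y / (1 - x) / C \<le> \<omega> (of_real s)"
        using C(1) by (simp only: pos_divide_le_eq mult.commute)
    qed (use xy in auto)
    then show ?thesis using const[OF xy(2)] by (simp add: mult_ac)
  qed
  define h where "h r = T (max 0 (min r 1))" for r
  have hT: "h r = T r" if "0 \<le> r" "r < 1" for r using that by (simp add: h_def)
  have "regular_tail h C"
    by unfold_locales (use C(1) T_pos' diff_nonneg T_upper T_lower in \<open>simp_all add: hT\<close>)
  moreover have "h \<in> borel_measurable borel"
  proof -
    have T1: "T 1 = 0" by (simp add: T_def tail_integral_def set_lebesgue_integral_def)
    have "T y \<le> T x" if "0 \<le> x" "x \<le> y" "y \<le> 1" for x y
      using diff_nonneg[of x y] T_pos'[of x] T1 that by (cases "y = 1"; cases "x = 1") auto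
    then have "mono (\<lambda>r. - h r)" by (auto simp: mono_def h_def)
    then have "(\<lambda>r. - h r) \<in> borel_measurable borel" by (rule borel_measurable_mono)
    from borel_measurable_uminus[OF this] show ?thesis by simp
  qed
  ultimately show ?thesis
    using that[of C] w_le w_ge unfolding h_def[abs_def] T_def by blast
qed

section \<open>Composition with a self-map of the disk\<close>

locale disk_self_map =
  fixes \<phi> :: "complex \<Rightarrow> complex"
  assumes hol: "\<phi> holomorphic_on unit_disk" and self: "\<phi> ` unit_disk \<subseteq> unit_disk"
begin

lemma norm_lt_1: "cmod z < 1 \<Longrightarrow> cmod (\<phi> z) < 1"
  using self by (auto simp: image_subset_iff)

text \<open>The constant of Schwarz--Pick with base point 0. It also bounds
  \<open>(1 + w) / (1 - w)\<close> at the origin for every \<open>w = cnj \<zeta> * \<phi>\<close>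
  with \<open>|\<zeta>| < 1\<close>.\<close>

definition K where "K = (1 + cmod (\<phi> 0)) / (1 - cmod (\<phi> 0))"

lemma K_ge_1: "1 \<le> K"
  using norm_lt_1[of 0] by (simp add: K_def)

text \<open>Schwarz--Pick with base point 0: the denominator is at least
  \<open>(1 - b)\<^sup>2\<close>, where \<open>b = |\<phi> 0|\<close>, and
  \<open>(1 - b\<^sup>2) / (1 - b)\<^sup>2 = K\<close>. It forces a point whose image is near the
  boundary to be near the boundary itself.\<close>

lemma boundary_dist_le:
  assumes z: "cmod z < 1"
  shows "1 - cmod z \<le> 2 * K * (1 - cmod (\<phi> z))"
proof -
  define b where "b = cmod (\<phi> 0)"
  have b: "0 \<le> b" "b < 1" using norm_lt_1[of 0] by (simp_all add: b_def)
  have fz: "cmod (\<phi> z) < 1" using norm_lt_1[OF z] .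
  have sq: "0 \<le> 1 - (cmod (\<phi> z))\<^sup>2" "0 \<le> 1 - b\<^sup>2"
    using fz b by (simp_all add: abs_square_le_1)
  have "cmod (cnj (\<phi> 0) * \<phi> z) \<le> b * 1"
    unfolding norm_mult complex_mod_cnj b_def using fz by (intro mult_left_mono) auto
  then have "1 - b \<le> cmod (1 - cnj (\<phi> 0) * \<phi> z)"
    using norm_triangle_ineq2[of 1 "cnj (\<phi> 0) * \<phi> z"] by simp
  then have d: "(1 - b)\<^sup>2 \<le> (cmod (1 - cnj (\<phi> 0) * \<phi> z))\<^sup>2"
    using b by (intro power_mono) auto
  have "1 - (cmod z)\<^sup>2
      \<le> (1 - b\<^sup>2) * (1 - (cmod (\<phi> z))\<^sup>2) / (cmod (1 - cnj (\<phi> 0) * \<phi> z))\<^sup>2"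
    using schwarz_pick[OF hol self, of 0 z] z by (simp add: b_def)
  also have "\<dots> \<le> (1 - b\<^sup>2) * (1 - (cmod (\<phi> z))\<^sup>2) / (1 - b)\<^sup>2"
    using d b sq by (intro divide_left_mono mult_nonneg_nonneg mult_pos_pos zero_less_power) auto
  also have "\<dots> = K * (1 - (cmod (\<phi> z))\<^sup>2)"
  proof -
    have "1 - b\<^sup>2 = (1 - b) * (1 + b)" by (simp add: power2_eq_square algebra_simps)
    then show ?thesis using b unfolding K_def b_def[symmetric] by (simp add: power2_eq_square)
  qed
  also have "\<dots> \<le> K * (2 * (1 - cmod (\<phi> z)))"
  proof (rule mult_left_mono)
    have "(1 - cmod (\<phi> z)) * (1 + cmod (\<phi> z)) \<le> (1 - cmod (\<phi> z)) * 2"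
      using fz by (intro mult_left_mono) auto
    then show "1 - (cmod (\<phi> z))\<^sup>2 \<le> 2 * (1 - cmod (\<phi> z))"
      by (simp add: algebra_simps power2_eq_square)
  qed (use K_ge_1 in simp)
  finally have "1 - (cmod z)\<^sup>2 \<le> 2 * K * (1 - cmod (\<phi> z))" by (simp add: algebra_simps)
  moreover have "(cmod z)\<^sup>2 \<le> cmod z"
    using z by (simp add: power2_eq_square mult_left_le)
  ultimately show ?thesis by linarith
qed

text \<open>
  The function \<open>F = (1 + w) / (1 - w)\<close> with \<open>w = cnj \<zeta> * \<phi>\<close> has positive real part, which is
  large where \<open>1 - w\<close> is small, while its mean over every disk about the origin is \<open>F 0\<close>.
\<close>

lemma measure_annulus_near_le:
  assumes meas[measurable]: "\<phi> \<in> borel_measurable borel"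
    and z: "cmod \<zeta> < 1" and r: "0 \<le> r1" "r1 \<le> r2" "r2 < 1"
  shows "emeasure lborel {z. r1 \<le> cmod z \<and> cmod z < r2 \<and> cmod (1 - cnj \<zeta> * \<phi> z) \<le> 5 * (1 - cmod \<zeta>)}
    \<le> ennreal (25 * K * (1 - cmod \<zeta>) * pi * (r2\<^sup>2 - r1\<^sup>2))"
proof -
  define E where "E = {z. r1 \<le> cmod z \<and> cmod z < r2 \<and> cmod (1 - cnj \<zeta> * \<phi> z) \<le> 5 * (1 - cmod \<zeta>)}"
  define F where "F z = (1 + cnj \<zeta> * \<phi> z) / (1 - cnj \<zeta> * \<phi> z)" for z
  define s where "s = cmod \<zeta>"
  have s: "0 \<le> s" "s < 1" using z by (simp_all add: s_def)
  have E[measurable]: "E \<in> sets borel" unfolding E_def by measurable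
  have ne: "1 - cnj \<zeta> * \<phi> w \<noteq> 0" if "cmod w < 1" for w
    using disk_mult_cnj_ne_1[OF z norm_lt_1[OF that]] .
  have holF: "F holomorphic_on ball 0 1"
    unfolding F_def by (intro holomorphic_intros hol) (use ne in auto)
  have ReF: "Re (F w) = (1 - (cmod (cnj \<zeta> * \<phi> w))\<^sup>2) / (cmod (1 - cnj \<zeta> * \<phi> w))\<^sup>2" for w
  proof -
    have "Re ((1 + c) / (1 - c)) = (1 - (cmod c)\<^sup>2) / (cmod (1 - c))\<^sup>2" for c
      unfolding Re_divide cmod_power2 by (simp add: algebra_simps power2_eq_square)
    then show ?thesis by (simp only: F_def)
  qed
  have lt: "cmod (cnj \<zeta> * \<phi> w) \<le> s" if "cmod w < 1" for w
    unfolding norm_mult complex_mod_cnj s_def using norm_lt_1[OF that] by (simp add: mult_left_le)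
  have Re_ge: "(1 - s) / (cmod (1 - cnj \<zeta> * \<phi> w))\<^sup>2 \<le> Re (F w)" if "cmod w < 1" for w
  proof -
    have "(cmod (cnj \<zeta> * \<phi> w))\<^sup>2 \<le> s * s"
      unfolding power2_eq_square using lt[OF that] s by (intro mult_mono) auto
    also have "s * s \<le> s" using s by (simp add: mult_left_le)
    finally show ?thesis unfolding ReF by (intro divide_right_mono) auto
  qed
  have Re_nonneg: "0 \<le> Re (F w)" if "cmod w < 1" for w
    using Re_ge[OF that] s by (meson divide_nonneg_nonneg diff_ge_0_iff_ge less_imp_le order_trans zero_le_power2)
  \<comment> \<open>Chebyshev's argument: on \<open>E\<close> the denominator in
    \<open>Re_ge\<close> is at most \<open>(5 * (1 - s))\<^sup>2\<close>, so
    \<open>25 * (1 - s)\<close> times the nonnegative \<open>Re F\<close> dominates the indicator of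
    \<open>E\<close>.\<close>
  have Re_E: "1 \<le> 25 * (1 - s) * Re (F w)" if "w \<in> E" for w
  proof -
    have w: "cmod w < 1" using that r by (auto simp: E_def)
    have "(cmod (1 - cnj \<zeta> * \<phi> w))\<^sup>2 \<le> (5 * (1 - s))\<^sup>2"
      using that by (intro power_mono) (auto simp: E_def s_def)
    then have "(1 - s) / (5 * (1 - s))\<^sup>2 \<le> (1 - s) / (cmod (1 - cnj \<zeta> * \<phi> w))\<^sup>2"
      using s ne[OF w] by (intro divide_left_mono mult_pos_pos) auto
    then have "(1 - s) / (5 * (1 - s))\<^sup>2 \<le> Re (F w)" using Re_ge[OF w] by linarith
    then have "25 * (1 - s) * ((1 - s) / (5 * (1 - s))\<^sup>2) \<le> 25 * (1 - s) * Re (F w)"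
      using s by (intro mult_left_mono) auto
    moreover have "25 * (1 - s) * ((1 - s) / (5 * (1 - s))\<^sup>2) = 1"
    proof -
      have eq: "25 * e * (e / (5 * e)\<^sup>2) = 1" if "e \<noteq> 0" for e :: real
        using that by (simp add: power2_eq_square)
      show ?thesis by (rule eq) (use s in simp)
    qed
    ultimately show ?thesis by simp
  qed
  have contF: "continuous_on (cball 0 t) F" if "t < 1" for t
    by (rule holomorphic_on_imp_continuous_on[OF holomorphic_on_subset[OF holF]]) (use that in auto)
  have int: "set_integrable lborel (ball 0 t) (\<lambda>z. Re (F z))" if "t < 1" for t
    by (intro set_integrable_ball_continuous continuous_on_Re contF that)
  have mean: "(LINT z:ball 0 t|lborel. Re (F z)) = pi * t\<^sup>2 * Re (F 0)" if "0 \<le> t" "t < 1" for t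
  proof (cases "t = 0")
    case False
    have I: "set_integrable lborel (ball 0 t) F"
      by (rule set_integrable_ball_continuous[OF contF[OF that(2)]])
    have "(LINT z:ball 0 t|lborel. Re (F z)) = Re (LINT z:ball 0 t|lborel. F z)"
      using integral_Re[OF I[unfolded set_integrable_def]]
      by (simp only: set_lebesgue_integral_def scaleR_complex.sel real_scaleR_def)
    then show ?thesis
      using area_mean_value[OF holF, of t] False that by simp
  qed (simp add: set_lebesgue_integral_def)
  \<comment> \<open>Subtracting the integrals over two concentric disks shows that the mean over the
    annulus is still \<open>Re (F 0)\<close>, so the bound scales with the area however thin the
    annulus is.\<close>
  let ?A = "ball 0 r2 - ball 0 r1 :: complex set"
  have r1: "r1 < 1" using r by simp
  have intA: "set_integrable lborel ?A (\<lambda>z. Re (F z))"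
    by (rule set_integrable_subset[OF int[OF r(3)]]) auto
  have "?A \<union> ball 0 r1 = ball 0 r2" using r by auto
  then have split: "(LINT z:ball 0 r2|lborel. Re (F z))
      = (LINT z:?A|lborel. Re (F z)) + (LINT z:ball 0 r1|lborel. Re (F z))"
    using set_integral_Un[OF _ intA int[OF r1]] by auto
  have F0: "Re (F 0) \<le> K"
  proof -
    define b where "b = cmod (\<phi> 0)"
    have b: "0 \<le> b" "b < 1" using norm_lt_1[of 0] by (simp_all add: b_def)
    have *: "cmod (cnj \<zeta> * \<phi> 0) \<le> b"
      unfolding norm_mult complex_mod_cnj b_def using z by (simp add: mult_left_le_one_le)
    have "Re (F 0) \<le> cmod (F 0)" by (rule complex_Re_le_cmod)
    also have "\<dots> = cmod (1 + cnj \<zeta> * \<phi> 0) / cmod (1 - cnj \<zeta> * \<phi> 0)"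
      by (simp add: F_def norm_divide)
    also have "\<dots> \<le> (1 + b) / (1 - b)"
    proof (rule frac_le)
      show "cmod (1 + cnj \<zeta> * \<phi> 0) \<le> 1 + b"
        using norm_triangle_ineq[of 1 "cnj \<zeta> * \<phi> 0"] * by simp
      show "1 - b \<le> cmod (1 - cnj \<zeta> * \<phi> 0)"
        using norm_triangle_ineq2[of 1 "cnj \<zeta> * \<phi> 0"] * by simp
    qed (use b in auto)
    finally show ?thesis by (simp add: K_def b_def)
  qed
  have finE: "emeasure lborel E < \<infinity>"
    by (intro emeasure_bounded_finite bounded_subset[OF bounded_ball[of 0 r2]]) (auto simp: E_def)
  have EA: "E \<subseteq> ?A" by (auto simp: E_def)
  have "measure lborel E = (LINT z:?A|lborel. indicator E z)"
    using EA by (simp add: set_lebesgue_integral_def indicator_inter_arith[symmetric] Int_absorb1)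
  also have "\<dots> \<le> (LINT z:?A|lborel. 25 * (1 - s) * Re (F z))"
  proof (rule set_integral_mono)
    show "set_integrable lborel ?A (indicator E :: complex \<Rightarrow> real)"
      unfolding set_integrable_def using finE EA
      by (simp add: indicator_inter_arith[symmetric] Int_absorb1)
    show "set_integrable lborel ?A (\<lambda>z. 25 * (1 - s) * Re (F z))"
      by (rule set_integrable_mult_right[OF intA])
    fix w :: complex assume "w \<in> ?A"
    then have "cmod w < 1" using r by auto
    then show "indicator E w \<le> 25 * (1 - s) * Re (F w)"
      using Re_E[of w] Re_nonneg[of w] s by (auto simp: indicator_def)
  qed
  also have "\<dots> = 25 * (1 - s) * (pi * (r2\<^sup>2 - r1\<^sup>2) * Re (F 0))"
    unfolding set_integral_mult_right using split mean[of r1] mean[of r2] r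
    by (simp add: algebra_simps)
  also have "\<dots> \<le> 25 * (1 - s) * (pi * (r2\<^sup>2 - r1\<^sup>2) * K)"
    using F0 s r by (intro mult_left_mono) auto
  finally have "measure lborel E \<le> 25 * K * (1 - s) * pi * (r2\<^sup>2 - r1\<^sup>2)" by (simp add: mult_ac)
  then show ?thesis
    using finE unfolding E_def[symmetric] s_def by (simp add: emeasure_eq_ennreal_measure ennreal_leI)
qed

end


section \<open>Weighted area of the points mapped near a given point\<close>

locale weighted_self_map = disk_self_map \<phi> + regular_tail h C
  for \<phi> h C +
  fixes \<delta> :: real
  assumes \<phi>_meas [measurable]: "\<phi> \<in> borel_measurable borel"
    and h_meas [measurable]: "h \<in> borel_measurable borel"
    and \<delta>: "0 < \<delta>" "\<delta> < 1" "decay_rate * 2 powr \<delta> < 1"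
begin

text \<open>When \<open>h\<close> is the tail of a regular weight, this is comparable to the weight
  on the disk and so gives the same Bergman space, while bounds on \<open>h\<close> apply to it
  directly.\<close>

definition W :: "complex \<Rightarrow> real" where
  "W z = h (cmod z) / (1 - cmod z)"

lemma W_nonneg: "cmod z < 1 \<Longrightarrow> 0 \<le> W z"
  using pos[of "cmod z"] by (simp add: W_def)

lemma W_meas [measurable]: "W \<in> borel_measurable borel"
  unfolding W_def[abs_def] by measurable

text \<open>On the \<open>k\<close>-th dyadic annulus the integrand is of order
  \<open>decay_rate ^ k * h x\<close> times the power \<open>-\<delta> - 1\<close> of the boundary
  distance, and the area is of order \<open>1 - |\<zeta>|\<close> times that distance. The distance
  halves with each \<open>k\<close>, so the terms are geometric.\<close>

lemma weighted_area_near_le: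
  assumes z: "cmod \<zeta> < 1" and x: "0 \<le> x" "x < 1"
  defines "E \<equiv> {z. x \<le> cmod z \<and> cmod z < 1 \<and> cmod (1 - cnj \<zeta> * \<phi> z) \<le> 5 * (1 - cmod \<zeta>)}"
  shows "(\<integral>\<^sup>+z\<in>E. ennreal ((1 - cmod z) powr (-\<delta>) * W z) \<partial>lborel)
    \<le> ennreal (50 * pi * K * 2 powr \<delta> / (1 - decay_rate * 2 powr \<delta>)
        * ((1 - cmod \<zeta>) * h x * (1 - x) powr (-\<delta>)))"
proof -
  define m where "m k = (1 - x) / 2 ^ k" for k :: nat
  define A where "A k = {z::complex. 1 - m k \<le> cmod z \<and> cmod z < 1 - m (Suc k)
      \<and> cmod (1 - cnj \<zeta> * \<phi> z) \<le> 5 * (1 - cmod \<zeta>)}" for k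
  \<comment> \<open>The extra -1 in the exponent is the denominator of \<open>W\<close>; on
    \<open>A k\<close> the power stays below its value at the outer edge, at distance
    \<open>m (Suc k)\<close>.\<close>
  define c where "c k = decay_rate ^ k * h x * m (Suc k) powr (-\<delta> - 1)" for k
  define S where "S = 50 * pi * K * (1 - cmod \<zeta>) * h x * (1 - x) powr (-\<delta>) * 2 powr \<delta>"
  have hx: "0 < h x" by (rule pos[OF x])
  have m: "0 < m k" "m (Suc k) = m k / 2" "m k \<le> 1" for k
  proof -
    show "0 < m k" "m (Suc k) = m k / 2" using x by (simp_all add: m_def)
    have "(1 - x) * 1 \<le> 1 * 2 ^ k" using x by (intro mult_mono) auto
    then show "m k \<le> 1" by (simp add: m_def pos_divide_le_eq)
  qed
  have [measurable]: "E \<in> sets borel" "A k \<in> sets borel" for k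
    unfolding E_def A_def by measurable
  have c0: "0 \<le> c k" for k using decay_rate hx by (simp add: c_def)
  have ptw: "ennreal ((1 - cmod z) powr (-\<delta>) * W z) * indicator E z
      \<le> (\<Sum>k. ennreal (c k) * indicator (A k) z)" for z
  proof (cases "z \<in> E")
    case True
    then have z: "x \<le> cmod z" "cmod z < 1" "cmod (1 - cnj \<zeta> * \<phi> z) \<le> 5 * (1 - cmod \<zeta>)"
      by (auto simp: E_def)
    have "\<exists>k. cmod z < 1 - m (Suc k)"
    proof -
      obtain k where "(1 / 2) ^ k < 1 - cmod z" using real_arch_pow_inv[of "1 - cmod z" "1 / 2"] z by auto
      moreover have "m (Suc k) \<le> (1 / 2) ^ k"
      proof -
        have "m k = (1 - x) * (1 / 2) ^ k" by (simp add: m_def power_divide)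
        also have "\<dots> \<le> 1 * (1 / 2) ^ k" using x by (intro mult_right_mono) auto
        finally show ?thesis using m[of k] by simp
      qed
      ultimately show ?thesis by (intro exI[of _ k]) simp
    qed
    \<comment> \<open>Minimality of \<open>k\<close> supplies the inner bound on
      \<open>|z|\<close>.\<close>
    then obtain k where k: "cmod z < 1 - m (Suc k)" "\<And>j. j < k \<Longrightarrow> \<not> cmod z < 1 - m (Suc j)"
      using exists_least_iff[of "\<lambda>k. cmod z < 1 - m (Suc k)"] by blast
    have lo: "1 - m k \<le> cmod z"
    proof (cases k)
      case 0
      then show ?thesis using z by (simp add: m_def)
    next
      case (Suc j)
      then show ?thesis using k(2)[of j] by simp
    qed
    have zA: "z \<in> A k" using k(1) lo z by (simp add: A_def)
    have "h (cmod z) \<le> h (1 - m k)"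
      using lo z m(1,3)[of k] by (intro antimono) auto
    also have "\<dots> \<le> decay_rate ^ k * h x" unfolding m_def by (rule decay[OF x])
    finally have hz: "h (cmod z) \<le> decay_rate ^ k * h x" .
    have "(1 - cmod z) powr (-\<delta>) * W z = h (cmod z) * (1 - cmod z) powr (-\<delta> - 1)"
      using z by (simp add: W_def powr_diff)
    also have "\<dots> \<le> (decay_rate ^ k * h x) * m (Suc k) powr (-\<delta> - 1)"
      using hz k(1) m(1)[of "Suc k"] \<delta> decay_rate hx
      by (intro mult_mono powr_mono2') auto
    finally have "(1 - cmod z) powr (-\<delta>) * W z \<le> c k" by (simp add: c_def)
    then have "ennreal ((1 - cmod z) powr (-\<delta>) * W z) \<le> (\<Sum>j\<in>{k}. ennreal (c j) * indicator (A j) z)"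
      using zA by (simp add: ennreal_leI)
    also have "\<dots> \<le> (\<Sum>k. ennreal (c k) * indicator (A k) z)"
      by (rule sum_le_suminf) auto
    finally show ?thesis using True by simp
  qed simp
  have term_le: "c k * (25 * K * (1 - cmod \<zeta>) * pi * ((1 - m (Suc k))\<^sup>2 - (1 - m k)\<^sup>2))
      \<le> S * (decay_rate * 2 powr \<delta>) ^ k" for k
  proof -
    let ?m = "m (Suc k)"
    have "(1 - m (Suc k))\<^sup>2 - (1 - m k)\<^sup>2 = ?m * (2 - 3 * ?m)"
    proof -
      have "m k = 2 * ?m" using m(2)[of k] by simp
      then show ?thesis by (simp only:) (simp add: power2_eq_square algebra_simps)
    qed
    also have "\<dots> \<le> ?m * 2" using m(1)[of "Suc k"] by (intro mult_left_mono) auto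
    finally have "c k * (25 * K * (1 - cmod \<zeta>) * pi * ((1 - m (Suc k))\<^sup>2 - (1 - m k)\<^sup>2))
        \<le> c k * (25 * K * (1 - cmod \<zeta>) * pi * (?m * 2))"
      using c0 K_ge_1 z by (intro mult_left_mono) auto
    also have "\<dots> = 50 * pi * K * (1 - cmod \<zeta>) * h x * decay_rate ^ k * (?m powr (-\<delta> - 1) * ?m)"
      by (simp add: c_def)
    also have "?m powr (-\<delta> - 1) * ?m = ?m powr (-\<delta>)"
      using m(1)[of "Suc k"] by (simp add: powr_diff)
    \<comment> \<open>The surplus factor from \<open>Suc k\<close> is the
      \<open>2 powr \<delta>\<close> in \<open>S\<close>.\<close>
    also have "?m powr (-\<delta>) = (1 - x) powr (-\<delta>) * (2 powr \<delta>) ^ Suc k"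
    proof -
      have "?m powr (-\<delta>) = (1 - x) powr (-\<delta>) / (2 ^ Suc k) powr (-\<delta>)"
        unfolding m_def by (rule powr_divide)
      also have "(2 ^ Suc k) powr (-\<delta>) = 1 / (2 powr \<delta>) ^ Suc k"
        by (simp only: powr_minus_divide powr_realpow[symmetric] powr_powr powr_gt_zero zero_less_numeral mult.commute)
      finally show ?thesis by simp
    qed
    finally show ?thesis by (simp add: S_def power_mult_distrib mult_ac)
  qed
  have q: "0 \<le> decay_rate * 2 powr \<delta>" using decay_rate by simp
  have "(\<integral>\<^sup>+z\<in>E. ennreal ((1 - cmod z) powr (-\<delta>) * W z) \<partial>lborel)
      \<le> (\<integral>\<^sup>+z. (\<Sum>k. ennreal (c k) * indicator (A k) z) \<partial>lborel)"
    by (intro nn_integral_mono ptw)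
  also have "\<dots> = (\<Sum>k. \<integral>\<^sup>+z. ennreal (c k) * indicator (A k) z \<partial>lborel)"
    by (rule nn_integral_suminf) measurable
  also have "\<dots> \<le> (\<Sum>k. ennreal (S * (decay_rate * 2 powr \<delta>) ^ k))"
  proof (rule suminf_le)
    fix k
    have "(\<integral>\<^sup>+z. ennreal (c k) * indicator (A k) z \<partial>lborel) = ennreal (c k) * emeasure lborel (A k)"
      by (rule nn_integral_cmult_indicator) simp
    also have "\<dots> \<le> ennreal (c k)
        * ennreal (25 * K * (1 - cmod \<zeta>) * pi * ((1 - m (Suc k))\<^sup>2 - (1 - m k)\<^sup>2))"
      unfolding A_def using m[of k] m(1)[of "Suc k"]
      by (intro mult_left_mono measure_annulus_near_le[OF \<phi>_meas z]) auto
    also have "\<dots> = ennreal (c k * (25 * K * (1 - cmod \<zeta>) * pi * ((1 - m (Suc k))\<^sup>2 - (1 - m k)\<^sup>2)))"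
      by (rule ennreal_mult'[symmetric]) (rule c0)
    also have "\<dots> \<le> ennreal (S * (decay_rate * 2 powr \<delta>) ^ k)"
      by (rule ennreal_leI[OF term_le])
    finally show "(\<integral>\<^sup>+z. ennreal (c k) * indicator (A k) z \<partial>lborel)
        \<le> ennreal (S * (decay_rate * 2 powr \<delta>) ^ k)" .
  qed auto
  also have "\<dots> = ennreal (S * (1 / (1 - decay_rate * 2 powr \<delta>)))"
  proof (rule suminf_ennreal_eq)
    show "0 \<le> S * (decay_rate * 2 powr \<delta>) ^ k" for k
      unfolding S_def using K_ge_1 z hx decay_rate by simp
    show "(\<lambda>k. S * (decay_rate * 2 powr \<delta>) ^ k) sums (S * (1 / (1 - decay_rate * 2 powr \<delta>)))"
      by (intro sums_mult geometric_sums) (use q \<delta> in auto)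
  qed
  also have "S * (1 / (1 - decay_rate * 2 powr \<delta>))
      = 50 * pi * K * 2 powr \<delta> / (1 - decay_rate * 2 powr \<delta>)
        * ((1 - cmod \<zeta>) * h x * (1 - x) powr (-\<delta>))"
    by (simp add: S_def)
  finally show ?thesis .
qed


text \<open>For these \<open>z\<close> the distance \<open>1 - |\<phi> z|\<close> is comparable to
  \<open>1 - |\<zeta>|\<close>, so the first factor is essentially constant and a weighted area near
  \<open>\<zeta>\<close> remains. Doubling compares its \<open>h x\<close> with
  \<open>h |\<zeta>|\<close>, and the exponents of \<open>1 - |\<zeta>|\<close>, namely
  \<open>\<delta> - 2\<close>, 1 and \<open>-\<delta>\<close>, add up to the -1 in
  \<open>W \<zeta>\<close>.\<close>

lemma pullback_kernel_le:
  obtains M where "0 \<le> M" and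
    "\<And>\<zeta>. cmod \<zeta> < 1 \<Longrightarrow>
      (\<integral>\<^sup>+z\<in>{z. cmod z < 1 \<and> cmod (\<zeta> - \<phi> z) < (1 - cmod (\<phi> z)) / 2}.
        ennreal ((1 - cmod (\<phi> z)) powr (\<delta> - 2) * ((1 - cmod z) powr (-\<delta>) * W z)) \<partial>lborel)
      \<le> ennreal (M * W \<zeta>)"
proof -
  obtain D where D: "0 < D"
    "\<And>x s. \<lbrakk>0 \<le> x; x < 1; 0 \<le> s; s < 1; 1 - x \<le> (4 * K) * (1 - s)\<rbrakk> \<Longrightarrow> h x \<le> D * h s"
    using doubling[of "4 * K"] by blast
  define N where "N = 50 * pi * K * 2 powr \<delta> / (1 - decay_rate * 2 powr \<delta>)"
  have N: "0 \<le> N" unfolding N_def using K_ge_1 \<delta> by simp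
  show ?thesis
  proof (rule that[of "9 / 4 * N * D"])
    show "0 \<le> 9 / 4 * N * D" using N D by simp
    fix \<zeta> :: complex assume z: "cmod \<zeta> < 1"
    define s where "s = cmod \<zeta>"
    have s: "0 \<le> s" "s < 1" using z by (auto simp: s_def)
    \<comment> \<open>The inner radius forced by \<open>boundary_dist_le\<close>:
      \<open>4 * K\<close> is \<open>2 * K\<close> times the 2 in
      \<open>1 - |\<phi> z| \<le> 2 * (1 - s)\<close>. The cut at 0 covers small
      \<open>\<zeta>\<close>.\<close>
    define x where "x = max 0 (1 - 4 * K * (1 - s))"
    define t where "t = 4 * K * (1 - s)"
    have "1 * (1 - s) \<le> 4 * K * (1 - s)" using s K_ge_1 by (intro mult_right_mono) auto
    then have "1 - s \<le> t" by (simp only: t_def mult_1_left)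
    then have "0 \<le> x" "x < 1" "x \<le> s" "1 - x \<le> t"
      unfolding x_def t_def[symmetric] using s by (auto simp: max_def)
    then have x: "0 \<le> x" "x < 1" "x \<le> s" "1 - x \<le> 4 * K * (1 - s)"
      by (simp_all only: t_def)
    define G where "G = {z. cmod z < 1 \<and> cmod (\<zeta> - \<phi> z) < (1 - cmod (\<phi> z)) / 2}"
    define E where "E = {z. x \<le> cmod z \<and> cmod z < 1 \<and> cmod (1 - cnj \<zeta> * \<phi> z) \<le> 5 * (1 - cmod \<zeta>)}"
    have GE: "z \<in> E" and le: "(1 - cmod (\<phi> z)) powr (\<delta> - 2) \<le> 9 / 4 * (1 - s) powr (\<delta> - 2)"
      if "z \<in> G" for z
    proof -
      have z: "cmod z < 1" "cmod (\<zeta> - \<phi> z) < (1 - cmod (\<phi> z)) / 2" using that by (auto simp: G_def)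
      have f: "cmod (\<phi> z) < 1" using norm_lt_1[OF z(1)] .
      have "s \<le> cmod (\<phi> z) + cmod (\<zeta> - \<phi> z)" "cmod (\<phi> z) \<le> s + cmod (\<zeta> - \<phi> z)"
        unfolding s_def using norm_triangle_sub[of \<zeta> "\<phi> z"] norm_triangle_sub[of "\<phi> z" \<zeta>]
        by (simp_all add: norm_minus_commute)
      with z(2) have d: "1 - cmod (\<phi> z) \<le> 2 * (1 - s)" "2 / 3 * (1 - s) \<le> 1 - cmod (\<phi> z)" by auto
      have "1 - cmod z \<le> 2 * K * (1 - cmod (\<phi> z))" by (rule boundary_dist_le[OF z(1)])
      also have "\<dots> \<le> 2 * K * (2 * (1 - s))" using d K_ge_1 by (intro mult_left_mono) auto
      also have "\<dots> = 4 * K * (1 - s)" by simp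
      finally have xz: "x \<le> cmod z" by (simp add: x_def diff_le_eq add.commute)
      \<comment> \<open>The first term is at most 2 and the second at most 1/2 times
        \<open>1 - |\<phi> z|\<close>, which is at most \<open>2 * (1 - s)\<close>; hence the 5 in
        \<open>E\<close>.\<close>
      have eq: "1 - cnj \<zeta> * \<phi> z = of_real (1 - (cmod (\<phi> z))\<^sup>2) + cnj (\<phi> z - \<zeta>) * \<phi> z"
      proof -
        have "of_real ((cmod (\<phi> z))\<^sup>2) = \<phi> z * cnj (\<phi> z)" by (rule complex_norm_square)
        then show ?thesis by (simp only: of_real_diff of_real_1 complex_cnj_diff) (simp add: algebra_simps)
      qed
      have "cmod (1 - cnj \<zeta> * \<phi> z) \<le> (1 - (cmod (\<phi> z))\<^sup>2) + cmod (\<zeta> - \<phi> z) * cmod (\<phi> z)"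
      proof -
        have "(cmod (\<phi> z))\<^sup>2 \<le> 1" using f by (simp add: abs_square_le_1)
        then have "cmod (of_real (1 - (cmod (\<phi> z))\<^sup>2)) = 1 - (cmod (\<phi> z))\<^sup>2"
          unfolding norm_of_real by simp
        then show ?thesis
          unfolding eq using norm_triangle_ineq[of "of_real (1 - (cmod (\<phi> z))\<^sup>2)" "cnj (\<phi> z - \<zeta>) * \<phi> z"]
          by (simp only: norm_mult complex_mod_cnj norm_minus_commute)
      qed
      also have "\<dots> \<le> 2 * (1 - cmod (\<phi> z)) + (1 - cmod (\<phi> z)) / 2 * 1"
      proof (intro add_mono mult_mono)
        have "(1 - cmod (\<phi> z)) * (1 + cmod (\<phi> z)) \<le> (1 - cmod (\<phi> z)) * 2"
          using f by (intro mult_left_mono) auto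
        then show "1 - (cmod (\<phi> z))\<^sup>2 \<le> 2 * (1 - cmod (\<phi> z))"
          by (simp add: algebra_simps power2_eq_square)
      qed (use f z in auto)
      also have "\<dots> \<le> 5 * (1 - s)"
        using mult_left_mono[OF d(1), of "5 / 2"] by (simp add: field_simps)
      finally show "z \<in> E" using xz z by (simp add: E_def s_def)
      have "(1 - cmod (\<phi> z)) powr (\<delta> - 2) \<le> (2 / 3 * (1 - s)) powr (\<delta> - 2)"
        using d s \<delta> by (intro powr_mono2') auto
      also have "\<dots> = (2 / 3) powr (\<delta> - 2) * (1 - s) powr (\<delta> - 2)"
        by (rule powr_mult)
      also have "\<dots> \<le> 9 / 4 * (1 - s) powr (\<delta> - 2)"
      proof (rule mult_right_mono)
        have "(2 / 3) powr (\<delta> - 2) \<le> (2 / 3 :: real) powr (- 2)"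
          using \<delta> by (intro powr_mono') auto
        also have "\<dots> = 9 / 4" by (simp add: powr_minus power2_eq_square)
        finally show "(2 / 3) powr (\<delta> - 2) \<le> (9 / 4 :: real)" .
      qed simp
      finally show "(1 - cmod (\<phi> z)) powr (\<delta> - 2) \<le> 9 / 4 * (1 - s) powr (\<delta> - 2)" .
    qed
    have [measurable]: "E \<in> sets borel" unfolding E_def by measurable
    have "(\<integral>\<^sup>+z\<in>G. ennreal ((1 - cmod (\<phi> z)) powr (\<delta> - 2) * ((1 - cmod z) powr (-\<delta>) * W z)) \<partial>lborel)
        \<le> (\<integral>\<^sup>+z. ennreal (9 / 4 * (1 - s) powr (\<delta> - 2))
            * (ennreal ((1 - cmod z) powr (-\<delta>) * W z) * indicator E z) \<partial>lborel)"
    proof (rule nn_integral_mono)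
      fix z
      show "ennreal ((1 - cmod (\<phi> z)) powr (\<delta> - 2) * ((1 - cmod z) powr (-\<delta>) * W z)) * indicator G z
          \<le> ennreal (9 / 4 * (1 - s) powr (\<delta> - 2))
            * (ennreal ((1 - cmod z) powr (-\<delta>) * W z) * indicator E z)"
      proof (cases "z \<in> G")
        case True
        then have "0 \<le> W z" by (intro W_nonneg) (simp add: G_def)
        then have "(1 - cmod (\<phi> z)) powr (\<delta> - 2) * ((1 - cmod z) powr (-\<delta>) * W z)
            \<le> 9 / 4 * (1 - s) powr (\<delta> - 2) * ((1 - cmod z) powr (-\<delta>) * W z)"
          by (intro mult_right_mono le[OF True]) simp
        moreover have "ennreal (9 / 4 * (1 - s) powr (\<delta> - 2) * ((1 - cmod z) powr (-\<delta>) * W z))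
            = ennreal (9 / 4 * (1 - s) powr (\<delta> - 2)) * ennreal ((1 - cmod z) powr (-\<delta>) * W z)"
          by (rule ennreal_mult') simp
        ultimately show ?thesis
          using GE[OF True] True by (metis ennreal_leI indicator_simps(1) mult_1_right)
      qed simp
    qed
    also have "\<dots> = ennreal (9 / 4 * (1 - s) powr (\<delta> - 2))
        * (\<integral>\<^sup>+z\<in>E. ennreal ((1 - cmod z) powr (-\<delta>) * W z) \<partial>lborel)"
      by (rule nn_integral_cmult) measurable
    also have "\<dots> \<le> ennreal (9 / 4 * (1 - s) powr (\<delta> - 2))
        * ennreal (N * ((1 - cmod \<zeta>) * h x * (1 - x) powr (-\<delta>)))"
      unfolding N_def E_def by (intro mult_left_mono weighted_area_near_le z x) auto
    also have "\<dots> = ennreal (9 / 4 * (1 - s) powr (\<delta> - 2) * (N * ((1 - s) * h x * (1 - x) powr (-\<delta>))))"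
      unfolding s_def by (rule ennreal_mult'[symmetric]) simp
    also have "\<dots> \<le> ennreal (9 / 4 * (1 - s) powr (\<delta> - 2) * (N * ((1 - s) * (D * h s) * (1 - s) powr (-\<delta>))))"
      using x s \<delta> N D pos[OF x(1,2)] pos[OF s] by (intro ennreal_leI mult_left_mono mult_mono powr_mono2') auto
    also have "9 / 4 * (1 - s) powr (\<delta> - 2) * (N * ((1 - s) * (D * h s) * (1 - s) powr (-\<delta>)))
        = 9 / 4 * N * D * W \<zeta>"
    proof -
      have "(1 - s) powr (\<delta> - 2) * (1 - s) powr (-\<delta>) = (1 - s) powr (-2)"
        by (simp add: powr_add[symmetric])
      also have "\<dots> = 1 / (1 - s)\<^sup>2" using s by (simp add: powr_minus_divide)
      finally have "9 / 4 * (1 - s) powr (\<delta> - 2) * (N * ((1 - s) * (D * h s) * (1 - s) powr (-\<delta>)))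
          = 9 / 4 * N * D * h s * ((1 - s) * (1 / (1 - s)\<^sup>2))"
        by (simp add: mult_ac)
      also have "(1 - s) * (1 / (1 - s)\<^sup>2) = 1 / (1 - s)" by (simp add: power2_eq_square)
      finally show ?thesis
        by (simp only: W_def s_def times_divide_eq_right mult_1_right)
    qed
    finally show "(\<integral>\<^sup>+z\<in>{z. cmod z < 1 \<and> cmod (\<zeta> - \<phi> z) < (1 - cmod (\<phi> z)) / 2}.
        ennreal ((1 - cmod (\<phi> z)) powr (\<delta> - 2) * ((1 - cmod z) powr (-\<delta>) * W z)) \<partial>lborel)
      \<le> ennreal (9 / 4 * N * D * W \<zeta>)"
      unfolding G_def .
  qed
qed

text \<open>The submean inequality on \<open>ball (\<phi> z) (e / 2)\<close>, where
  \<open>e = 1 - |\<phi> z|\<close>, bounds the integrand by an integral over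
  \<open>\<zeta>\<close>; Tonelli then puts the integration over \<open>z\<close> inside, where the
  kernel bound does not involve \<open>f\<close>.\<close>

lemma weighted_composition_estimate:
  fixes p :: real
  assumes p: "1 < p"
  obtains M where "0 \<le> M" and
    "\<And>f. \<lbrakk>f holomorphic_on unit_disk; f \<in> borel_measurable borel\<rbrakk> \<Longrightarrow>
      (\<integral>\<^sup>+z\<in>unit_disk. ennreal (cmod (f (\<phi> z)) powr p
          * (((1 - cmod (\<phi> z)) / (1 - cmod z)) powr \<delta> * W z)) \<partial>lborel)
      \<le> ennreal M * (\<integral>\<^sup>+z\<in>unit_disk. ennreal (cmod (f z) powr p * W z) \<partial>lborel)"
proof -
  obtain M where M: "0 \<le> M"
    "\<And>\<zeta>. cmod \<zeta> < 1 \<Longrightarrow>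
      (\<integral>\<^sup>+z\<in>{z. cmod z < 1 \<and> cmod (\<zeta> - \<phi> z) < (1 - cmod (\<phi> z)) / 2}.
        ennreal ((1 - cmod (\<phi> z)) powr (\<delta> - 2) * ((1 - cmod z) powr (-\<delta>) * W z)) \<partial>lborel)
      \<le> ennreal (M * W \<zeta>)"
    using pullback_kernel_le by blast
  show ?thesis
  proof (rule that[of "4 / pi * M"])
    show "0 \<le> 4 / pi * M" using M by simp
    fix f :: "complex \<Rightarrow> complex"
    assume f: "f holomorphic_on unit_disk" and f_meas[measurable]: "f \<in> borel_measurable borel"
    \<comment> \<open>\<open>e powr \<delta>\<close> divided by the disk area
      \<open>pi * e\<^sup>2 / 4\<close> leaves the exponent \<open>\<delta> - 2\<close> and the
      factor \<open>4 / pi\<close>.\<close>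
    define k where "k z = (1 - cmod (\<phi> z)) powr (\<delta> - 2) * ((1 - cmod z) powr (-\<delta>) * W z)" for z
    define G where "G = {(z, \<zeta>). cmod z < 1 \<and> cmod (\<zeta> - \<phi> z) < (1 - cmod (\<phi> z)) / 2}"
    have [measurable]: "k \<in> borel_measurable borel" unfolding k_def[abs_def] by measurable
    have [measurable]: "unit_disk \<in> sets borel" by simp
    have G[measurable]: "Measurable.pred (borel \<Otimes>\<^sub>M borel) (\<lambda>x. x \<in> G)"
      unfolding G_def by measurable
    have G_meas: "G \<in> sets (borel \<Otimes>\<^sub>M borel)"
      using G by (simp add: pred_def space_pair_measure)
    have k0: "0 \<le> k z" if "cmod z < 1" for z unfolding k_def using W_nonneg[OF that] by simp
    have inner: "ennreal (cmod (f (\<phi> z)) powr p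
          * (((1 - cmod (\<phi> z)) / (1 - cmod z)) powr \<delta> * W z)) * indicator unit_disk z
        \<le> (\<integral>\<^sup>+\<zeta>. ennreal (4 / pi) * (ennreal (k z) * ennreal (cmod (f \<zeta>) powr p) * indicator G (z, \<zeta>)) \<partial>lborel)"
      for z
    proof (cases "cmod z < 1")
      case True
      define e where "e = 1 - cmod (\<phi> z)"
      have e: "0 < e" using norm_lt_1[OF True] by (simp add: e_def)
      have holf: "f holomorphic_on ball (\<phi> z) e"
      proof (rule holomorphic_on_subset[OF f], rule subsetI)
        fix x assume "x \<in> ball (\<phi> z) e"
        then show "x \<in> unit_disk"
          using norm_triangle_sub[of x "\<phi> z"] by (simp add: e_def dist_norm norm_minus_commute)
      qed
      have sub: "ennreal (pi * (e / 2)\<^sup>2 * cmod (f (\<phi> z)) powr p)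
          \<le> (\<integral>\<^sup>+\<zeta>\<in>ball (\<phi> z) (e / 2). ennreal (cmod (f \<zeta>) powr p) \<partial>lborel)"
        by (rule area_submean_powr[OF holf _ _ p]) (use e in auto)
      have "cmod (f (\<phi> z)) powr p * (((1 - cmod (\<phi> z)) / (1 - cmod z)) powr \<delta> * W z)
          = (4 / pi * k z) * (pi * (e / 2)\<^sup>2 * cmod (f (\<phi> z)) powr p)"
      proof -
        have "(e / (1 - cmod z)) powr \<delta> = e powr \<delta> * (1 - cmod z) powr (-\<delta>)"
          using e True by (simp add: powr_divide powr_minus_divide)
        also have "e powr \<delta> = e powr (\<delta> - 2) * e\<^sup>2"
          using e powr_add[of e "\<delta> - 2" 2] by simp
        finally show ?thesis by (simp add: e_def[symmetric] k_def power2_eq_square)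
      qed
      moreover have "indicator unit_disk z = (1 :: ennreal)" using True by simp
      ultimately have "ennreal (cmod (f (\<phi> z)) powr p
          * (((1 - cmod (\<phi> z)) / (1 - cmod z)) powr \<delta> * W z)) * indicator unit_disk z
        = ennreal (4 / pi * k z) * ennreal (pi * (e / 2)\<^sup>2 * cmod (f (\<phi> z)) powr p)"
        using ennreal_mult'[of "4 / pi * k z" "pi * (e / 2)\<^sup>2 * cmod (f (\<phi> z)) powr p"] k0[OF True]
        by (simp only: mult_1_right) (simp add: zero_le_divide_iff)
      also have "\<dots> \<le> ennreal (4 / pi * k z)
          * (\<integral>\<^sup>+\<zeta>\<in>ball (\<phi> z) (e / 2). ennreal (cmod (f \<zeta>) powr p) \<partial>lborel)"
        by (intro mult_left_mono sub) simp
      also have "\<dots> = (\<integral>\<^sup>+\<zeta>. ennreal (4 / pi * k z)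
          * (ennreal (cmod (f \<zeta>) powr p) * indicator (ball (\<phi> z) (e / 2)) \<zeta>) \<partial>lborel)"
      proof (rule nn_integral_cmult[symmetric])
        have [measurable]: "ball (\<phi> z) (e / 2) \<in> sets borel" by simp
        show "(\<lambda>\<zeta>. ennreal (cmod (f \<zeta>) powr p) * indicator (ball (\<phi> z) (e / 2)) \<zeta>)
            \<in> borel_measurable lborel" by measurable
      qed
      also have "\<dots> = (\<integral>\<^sup>+\<zeta>. ennreal (4 / pi) * (ennreal (k z) * ennreal (cmod (f \<zeta>) powr p) * indicator G (z, \<zeta>)) \<partial>lborel)"
      proof -
        have "ennreal (4 / pi * k z) = ennreal (4 / pi) * ennreal (k z)"
          by (rule ennreal_mult') simp
        then show ?thesis
          using True
          by (intro nn_integral_cong)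
             (simp only:, auto simp: indicator_def G_def e_def dist_norm norm_minus_commute mult_ac)
      qed
      finally show ?thesis .
    qed simp
    have outer: "(\<integral>\<^sup>+z. ennreal (4 / pi) * (ennreal (k z) * ennreal (cmod (f \<zeta>) powr p) * indicator G (z, \<zeta>)) \<partial>lborel)
        \<le> ennreal (4 / pi * M) * (ennreal (cmod (f \<zeta>) powr p * W \<zeta>) * indicator unit_disk \<zeta>)" for \<zeta>
    proof (cases "cmod \<zeta> < 1")
      case True
      have "(\<integral>\<^sup>+z. ennreal (4 / pi) * (ennreal (k z) * ennreal (cmod (f \<zeta>) powr p) * indicator G (z, \<zeta>)) \<partial>lborel)
          = (\<integral>\<^sup>+z. (ennreal (4 / pi) * ennreal (cmod (f \<zeta>) powr p)) *
              (ennreal (k z) * indicator {z. cmod z < 1 \<and> cmod (\<zeta> - \<phi> z) < (1 - cmod (\<phi> z)) / 2} z) \<partial>lborel)"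
        by (intro nn_integral_cong) (simp add: indicator_def G_def mult_ac)
      also have "\<dots> = (ennreal (4 / pi) * ennreal (cmod (f \<zeta>) powr p)) *
          (\<integral>\<^sup>+z\<in>{z. cmod z < 1 \<and> cmod (\<zeta> - \<phi> z) < (1 - cmod (\<phi> z)) / 2}. ennreal (k z) \<partial>lborel)"
        by (rule nn_integral_cmult) measurable
      also have "\<dots> \<le> (ennreal (4 / pi) * ennreal (cmod (f \<zeta>) powr p)) * ennreal (M * W \<zeta>)"
        unfolding k_def by (intro mult_left_mono M True) auto
      also have "\<dots> = ennreal (4 / pi * M) * (ennreal (cmod (f \<zeta>) powr p * W \<zeta>) * indicator unit_disk \<zeta>)"
      proof -
        have "ennreal (M * W \<zeta>) = ennreal M * ennreal (W \<zeta>)"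
          "ennreal (4 / pi * M) = ennreal (4 / pi) * ennreal M"
          "ennreal (cmod (f \<zeta>) powr p * W \<zeta>) = ennreal (cmod (f \<zeta>) powr p) * ennreal (W \<zeta>)"
          using M(1) by (simp_all add: ennreal_mult' del: times_divide_eq_left)
        then show ?thesis using True by (simp only:) (simp add: mult_ac)
      qed
      finally show ?thesis .
    next
      case False
      \<comment> \<open>Disks of half the boundary distance stay inside the unit disk, so outer
        points \<open>\<zeta>\<close> contribute nothing.\<close>
      have "(z, \<zeta>) \<notin> G" for z
      proof
        assume "(z, \<zeta>) \<in> G"
        then have z: "cmod z < 1" "cmod (\<zeta> - \<phi> z) < (1 - cmod (\<phi> z)) / 2" by (auto simp: G_def)
        with norm_triangle_sub[of \<zeta> "\<phi> z"] norm_lt_1[OF z(1)] False show False by simp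
      qed
      then show ?thesis by simp
    qed
    interpret lborel_pair: pair_sigma_finite "lborel :: complex measure" "lborel :: complex measure" ..
    have "(\<integral>\<^sup>+z\<in>unit_disk. ennreal (cmod (f (\<phi> z)) powr p
          * (((1 - cmod (\<phi> z)) / (1 - cmod z)) powr \<delta> * W z)) \<partial>lborel)
        \<le> (\<integral>\<^sup>+z. \<integral>\<^sup>+\<zeta>. ennreal (4 / pi) * (ennreal (k z) * ennreal (cmod (f \<zeta>) powr p) * indicator G (z, \<zeta>)) \<partial>lborel \<partial>lborel)"
      by (intro nn_integral_mono inner)
    also have "\<dots> = (\<integral>\<^sup>+\<zeta>. \<integral>\<^sup>+z. ennreal (4 / pi) * (ennreal (k z) * ennreal (cmod (f \<zeta>) powr p) * indicator G (z, \<zeta>)) \<partial>lborel \<partial>lborel)"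
      by (rule lborel_pair.Fubini'[symmetric]) (use G_meas in measurable)
    also have "\<dots> \<le> (\<integral>\<^sup>+\<zeta>. ennreal (4 / pi * M) * (ennreal (cmod (f \<zeta>) powr p * W \<zeta>) * indicator unit_disk \<zeta>) \<partial>lborel)"
      by (intro nn_integral_mono outer)
    also have "\<dots> = ennreal (4 / pi * M) * (\<integral>\<^sup>+z\<in>unit_disk. ennreal (cmod (f z) powr p * W z) \<partial>lborel)"
      by (rule nn_integral_cmult) measurable
    finally show "(\<integral>\<^sup>+z\<in>unit_disk. ennreal (cmod (f (\<phi> z)) powr p
          * (((1 - cmod (\<phi> z)) / (1 - cmod z)) powr \<delta> * W z)) \<partial>lborel)
      \<le> ennreal (4 / pi * M) * (\<integral>\<^sup>+z\<in>unit_disk. ennreal (cmod (f z) powr p * W z) \<partial>lborel)" .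
  qed
qed

end

section \<open>Unbounded multipliers\<close>

text \<open>Coefficients \<open>4 ^ j\<close> work against peaks of size \<open>1 / 8 ^ j\<close>,
  both on compact subsets and relative to \<open>R powr \<eta>\<close>; the products sum like
  \<open>(1 / 2) ^ j\<close>. At its own point \<open>a j\<close> a peak has height 1, so there the
  coefficient is felt in full.\<close>

lemma gliding_hump:
  fixes \<phi> :: "complex \<Rightarrow> complex" and \<eta> :: real
  assumes hol: "\<phi> holomorphic_on ball 0 1" and self: "\<phi> ` ball 0 1 \<subseteq> ball 0 1"
    and c: "c < 1" "\<And>s. s < 1 \<Longrightarrow> \<exists>z. s < cmod z \<and> cmod z < 1 \<and> cmod (\<phi> z) \<le> c"
    and \<eta>: "0 < \<eta>" "\<eta> \<le> 1 / 2"
  obtains u M where "u holomorphic_on ball 0 1" "0 \<le> M"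
    "\<And>z. cmod z < 1 \<Longrightarrow> cmod (u z) \<le> M * ((1 - cmod (\<phi> z)) / (1 - cmod z)) powr \<eta>"
    "\<not> bounded (u ` ball 0 1)"
proof -
  have f1: "cmod (\<phi> z) < 1" if "cmod z < 1" for z
    using self that by (auto simp: image_subset_iff)
  define e where "e z = 1 - (cmod z)\<^sup>2" for z :: complex
  have e: "0 < e z" "1 - cmod z \<le> e z" "e z \<le> 2 * (1 - cmod z)" if "cmod z < 1" for z
  proof -
    have "e z = (1 - cmod z) * (1 + cmod z)" by (simp add: e_def power2_eq_square algebra_simps)
    moreover have "(1 - cmod z) * (1 + cmod z) \<le> (1 - cmod z) * 2" "(1 - cmod z) * 1 \<le> (1 - cmod z) * (1 + cmod z)"
      "0 < (1 - cmod z) * (1 + cmod z)"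
      using that by (intro mult_left_mono mult_pos_pos add_pos_nonneg; simp)+
    ultimately show "0 < e z" "1 - cmod z \<le> e z" "e z \<le> 2 * (1 - cmod z)" by (simp_all add: mult.commute)
  qed
  have small: "\<exists>z. cmod z < 1 \<and> cmod (\<phi> z) \<le> c \<and> e z \<le> t" if t: "0 < t" for t
  proof -
    obtain z where "max 0 (1 - t / 2) < cmod z" "cmod z < 1" "cmod (\<phi> z) \<le> c"
      using c(2)[of "max 0 (1 - t / 2)"] t by auto
    then show ?thesis using e(3)[of z] t by (intro exI[of _ z]) auto
  qed
  \<comment> \<open>The first condition on \<open>8 ^ j\<close> gives locally uniform convergence,
    the second the domination by \<open>R powr \<eta>\<close>.\<close>
  define good where "good j z \<longleftrightarrow> cmod z < 1 \<and> cmod (\<phi> z) \<le> c \<and> 8 ^ j * e z \<le> 1 \<and> 8 ^ j * e z powr \<eta> \<le> 1"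
    for j :: nat and z
  have good_small: "\<exists>z. good j z \<and> e z \<le> t" if t: "0 < t" for j t
  proof -
    define t' where "t' = min t (min (1 / 8 ^ j) ((1 / 8 ^ j) powr (1 / \<eta>)))"
    have "0 < t'" using t by (simp add: t'_def)
    from small[OF this] obtain z where z: "cmod z < 1" "cmod (\<phi> z) \<le> c" "e z \<le> t'" by blast
    have "e z powr \<eta> \<le> ((1 / 8 ^ j) powr (1 / \<eta>)) powr \<eta>"
      using z e(1)[OF z(1)] \<eta> by (intro powr_mono2) (auto simp: t'_def)
    also have "\<dots> = 1 / 8 ^ j" using \<eta> by (simp add: powr_powr)
    finally have "8 ^ j * e z powr \<eta> \<le> 1" by (simp add: field_simps)
    moreover have "8 ^ j * e z \<le> 1" "e z \<le> t" using z by (simp_all add: t'_def field_simps)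
    ultimately show ?thesis using z by (auto simp: good_def)
  qed
  \<comment> \<open>The next point depends on the previous one, so that later peaks are negligible
    at all earlier points; \<open>8 ^ Suc j\<close> beats the coefficient.\<close>
  obtain a where a: "\<And>j. good j (a j)" "\<And>j. e (a (Suc j)) \<le> e (a j) / 2 / 8 ^ Suc j"
  proof -
    have "\<exists>a. \<forall>j. good j (a j) \<and> e (a (Suc j)) \<le> e (a j) / 2 / 8 ^ Suc j"
    proof (rule dependent_nat_choice)
      show "\<exists>z. good 0 z" using good_small[of 1 0] by auto
      fix z j assume "good j z"
      then have "0 < e z / 2 / 8 ^ Suc j" using e(1)[of z] by (auto simp: good_def)
      from good_small[OF this, of "Suc j"]
      show "\<exists>y. good (Suc j) y \<and> e y \<le> e z / 2 / 8 ^ Suc j" .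
    qed
    then show ?thesis using that by blast
  qed
  have a1: "cmod (a j) < 1" "cmod (\<phi> (a j)) \<le> c" "8 ^ j * e (a j) \<le> 1" "8 ^ j * e (a j) powr \<eta> \<le> 1" for j
    using a(1)[of j] by (auto simp: good_def)
  have e_dec: "8 ^ j * e (a j) \<le> e (a m) / 2" if "m < j" for m j
    using that
  proof (induction j)
    case (Suc j)
    have step: "8 ^ Suc j * e (a (Suc j)) \<le> e (a j) / 2"
      using a(2)[of j] by (simp add: field_simps)
    show ?case
    proof (cases "m = j")
      case True
      then show ?thesis using step by simp
    next
      case False
      then have "8 ^ j * e (a j) \<le> e (a m) / 2" using Suc by simp
      moreover have "1 * e (a j) \<le> 8 ^ j * e (a j)"
        using e(1)[OF a1(1)[of j]] by (intro mult_right_mono) auto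
      moreover note step e(1)[OF a1(1)[of m]]
      ultimately show ?thesis by linarith
    qed
  qed simp
  define v where "v j z = of_real (e (a j)) / (1 - cnj (a j) * z)" for j z
  have v_hol: "v j holomorphic_on ball 0 1" for j
    unfolding v_def using disk_mult_cnj_ne_1[OF a1(1)] by (intro holomorphic_intros) auto
  have den: "1 - cmod z \<le> cmod (1 - cnj (a j) * z)" "1 - cmod (a j) \<le> cmod (1 - cnj (a j) * z)"
    if "cmod z < 1" for j z
  proof -
    have "cmod (cnj (a j) * z) \<le> cmod z" "cmod (cnj (a j) * z) \<le> cmod (a j)"
      using that a1(1)[of j] by (simp_all add: norm_mult mult_left_le mult_left_le_one_le)
    then show "1 - cmod z \<le> cmod (1 - cnj (a j) * z)" "1 - cmod (a j) \<le> cmod (1 - cnj (a j) * z)"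
      using norm_triangle_ineq2[of 1 "cnj (a j) * z"] by simp_all
  qed
  have v_norm: "cmod (v j z) = e (a j) / cmod (1 - cnj (a j) * z)" for j z
    using e(1)[OF a1(1)[of j]] by (simp add: v_def norm_divide)
  have v_le2: "cmod (v j z) \<le> 2" if "cmod z < 1" for j z
    unfolding v_norm using den(2)[OF that, of j] e(3)[OF a1(1)[of j]] disk_mult_cnj_ne_1[OF a1(1)[of j] that]
    by (simp add: pos_divide_le_eq)
  have v_le: "cmod (v j z) \<le> e (a j) / (1 - cmod z)" if "cmod z < 1" for j z
    unfolding v_norm using den(1)[OF that, of j] e(1)[OF a1(1)[of j]] that by (intro frac_le) auto
  have v_a: "v j (a j) = 1" for j
  proof -
    have "1 - cnj (a j) * a j = of_real (e (a j))"
      unfolding e_def using complex_norm_square[of "a j"] by (simp add: mult.commute)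
    then show ?thesis using e(1)[OF a1(1)[of j]] by (simp add: v_def)
  qed
  define R where "R z = (1 - cmod (\<phi> z)) / (1 - cmod z)" for z
  define B where "B = 2 * (2 / (1 - c)\<^sup>2) powr \<eta>"
  have B0: "0 \<le> B" by (simp add: B_def)
  have R0: "0 < R z" if "cmod z < 1" for z using f1[OF that] that by (simp add: R_def)
  text \<open>The Schwarz--Pick inequality between \<open>z\<close> and \<open>a j\<close> is what makes the peak \<open>v j\<close> small relative
    to the gain \<open>R\<close>, because \<open>\<phi> (a j)\<close> stays away from the boundary.\<close>
  have v_R: "cmod (v j z) \<le> B * e (a j) powr \<eta> * R z powr \<eta>" if z: "cmod z < 1" for j z
  proof -
    let ?b = "\<phi> (a j)"
    have b: "cmod ?b \<le> c" "cmod ?b < 1" using a1(2) f1[OF a1(1)] by auto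
    have fz: "cmod (\<phi> z) < 1" by (rule f1[OF z])
    have "cmod (cnj ?b * \<phi> z) \<le> c"
      using b fz mult_mono[of "cmod ?b" c "cmod (\<phi> z)" 1] norm_ge_zero[of ?b] by (simp add: norm_mult)
    then have dc: "1 - c \<le> cmod (1 - cnj ?b * \<phi> z)"
      using norm_triangle_ineq2[of 1 "cnj ?b * \<phi> z"] by simp
    have "e (a j) * e z / (cmod (1 - cnj (a j) * z))\<^sup>2
        \<le> e ?b * e (\<phi> z) / (cmod (1 - cnj ?b * \<phi> z))\<^sup>2"
      using schwarz_pick[OF hol self a1(1) z] by (simp add: e_def)
    also have "\<dots> \<le> 1 * e (\<phi> z) / (1 - c)\<^sup>2"
    proof (intro frac_le mult_right_mono)
      show "e ?b \<le> 1" by (simp add: e_def)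
      show "(1 - c)\<^sup>2 \<le> (cmod (1 - cnj ?b * \<phi> z))\<^sup>2" using dc c by (intro power_mono) auto
    qed (use e(1)[OF fz] c in auto)
    also have "\<dots> \<le> 2 * (1 - cmod (\<phi> z)) / (1 - c)\<^sup>2"
      using e(3)[OF fz] by (intro divide_right_mono) auto
    finally have sp: "e (a j) * e z / (cmod (1 - cnj (a j) * z))\<^sup>2 \<le> 2 * (1 - cmod (\<phi> z)) / (1 - c)\<^sup>2" .
    have ea: "0 < e (a j)" by (rule e(1)[OF a1(1)])
    have "(cmod (v j z))\<^sup>2 * (1 - cmod z) \<le> (cmod (v j z))\<^sup>2 * e z"
      using e(2)[OF z] by (intro mult_left_mono) auto
    also have "\<dots> = e (a j) * (e (a j) * e z / (cmod (1 - cnj (a j) * z))\<^sup>2)"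
      unfolding v_norm by (simp add: power2_eq_square)
    also have "\<dots> \<le> e (a j) * (2 * (1 - cmod (\<phi> z)) / (1 - c)\<^sup>2)"
      using sp ea by (intro mult_left_mono) auto
    finally have "(cmod (v j z))\<^sup>2 \<le> e (a j) * (2 * (1 - cmod (\<phi> z)) / (1 - c)\<^sup>2) / (1 - cmod z)"
      by (subst pos_le_divide_eq) (use z in simp_all)
    also have "\<dots> = 2 / (1 - c)\<^sup>2 * e (a j) * R z"
      by (simp add: R_def)
    finally have v2: "(cmod (v j z))\<^sup>2 \<le> 2 / (1 - c)\<^sup>2 * e (a j) * R z" .
    have v0: "0 < cmod (v j z)"
      using ea disk_mult_cnj_ne_1[OF a1(1)[of j] z] by (simp add: v_norm)
    \<comment> \<open>Interpolation: Schwarz--Pick bounds the square of \<open>v\<close>, and the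
      bound 2 takes care of the remaining power, whose exponent is nonnegative since
      \<open>\<eta> \<le> 1 / 2\<close>.\<close>
    have "cmod (v j z) = cmod (v j z) powr (1 - 2 * \<eta>) * cmod (v j z) powr (2 * \<eta>)"
      using v0 by (simp add: powr_add[symmetric])
    also have "cmod (v j z) powr (2 * \<eta>) = ((cmod (v j z))\<^sup>2) powr \<eta>"
      using v0 powr_powr[of "cmod (v j z)" 2 \<eta>] by simp
    also have "cmod (v j z) powr (1 - 2 * \<eta>) * ((cmod (v j z))\<^sup>2) powr \<eta>
        \<le> 2 * (2 / (1 - c)\<^sup>2 * e (a j) * R z) powr \<eta>"
    proof (rule mult_mono)
      have "cmod (v j z) powr (1 - 2 * \<eta>) \<le> 2 powr (1 - 2 * \<eta>)"
        using v_le2[OF z, of j] v0 \<eta> by (intro powr_mono2) auto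
      also have "\<dots> \<le> 2 powr 1" using \<eta> by (intro powr_mono) auto
      finally show "cmod (v j z) powr (1 - 2 * \<eta>) \<le> 2" by simp
      show "((cmod (v j z))\<^sup>2) powr \<eta> \<le> (2 / (1 - c)\<^sup>2 * e (a j) * R z) powr \<eta>"
        using v2 \<eta> by (intro powr_mono2) auto
    qed auto
    also have "2 * (2 / (1 - c)\<^sup>2 * e (a j) * R z) powr \<eta> = B * e (a j) powr \<eta> * R z powr \<eta>"
      by (simp only: B_def powr_mult mult.assoc)
    finally show ?thesis .
  qed
  define w where "w j z = 4 ^ j * v j z" for j z
  have w_norm: "cmod (w j z) = 4 ^ j * cmod (v j z)" for j z
    by (simp add: w_def norm_mult norm_power)
  have half: "(4::real) ^ j = 8 ^ j * (1 / 2) ^ j" for j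
    by (simp add: power_mult_distrib[symmetric])
  have half': "(4::real) ^ j * (x / y) = (8 ^ j * x) * ((1 / 2) ^ j / y)" for j x y
    unfolding half by simp
  have w_le: "cmod (w j z) \<le> (1 / 2) ^ j / (1 - cmod z)" if "cmod z < 1" for j z
  proof -
    have "cmod (w j z) \<le> 4 ^ j * (e (a j) / (1 - cmod z))"
      unfolding w_norm using v_le[OF that] by (intro mult_left_mono) auto
    also have "\<dots> = (8 ^ j * e (a j)) * ((1 / 2) ^ j / (1 - cmod z))" by (rule half')
    also have "\<dots> \<le> 1 * ((1 / 2) ^ j / (1 - cmod z))"
      using a1(3)[of j] that by (intro mult_right_mono) auto
    finally show ?thesis by simp
  qed
  have sg: "summable (\<lambda>j. (1 / 2 :: real) ^ j)" "(\<Sum>j. (1 / 2 :: real) ^ j) = 2"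
    using geometric_sums[of "1 / 2 :: real"] by (auto simp: sums_iff)
  have w_sum: "summable (\<lambda>j. norm (w j z))" if "cmod z < 1" for z
  proof (rule summable_comparison_test'[where N = 0])
    show "summable (\<lambda>j. (1 / 2) ^ j * (1 / (1 - cmod z)))" by (intro summable_mult2 sg)
    show "norm (norm (w j z)) \<le> (1 / 2) ^ j * (1 / (1 - cmod z))" for j
      using w_le[OF that, of j] by simp
  qed
  define u where "u z = (\<Sum>j. w j z)" for z
  have u_hol: "u holomorphic_on ball 0 1"
  proof (rule holomorphic_uniform_sequence[where f = "\<lambda>n z. \<Sum>j<n. w j z"])
    show "(\<lambda>z. \<Sum>j<n. w j z) holomorphic_on ball 0 1" for n
      unfolding w_def by (intro holomorphic_intros v_hol)
    fix x :: complex assume "x \<in> ball 0 1"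
    then have x: "cmod x < 1" by simp
    define d where "d = (1 - cmod x) / 2"
    have d: "0 < d" using x by (simp add: d_def)
    have near: "cmod z \<le> 1 - d" if "z \<in> cball x d" for z
      using norm_triangle_sub[of z x] that by (simp add: d_def dist_norm norm_minus_commute field_simps)
    have "uniform_limit (cball x d) (\<lambda>n z. \<Sum>j<n. w j z) (\<lambda>z. \<Sum>j. w j z) sequentially"
    proof (rule Weierstrass_m_test)
      show "summable (\<lambda>j. (1 / 2) ^ j * (1 / d))" by (intro summable_mult2 sg)
      fix j z assume z: "z \<in> cball x d"
      have "cmod (w j z) \<le> (1 / 2) ^ j / (1 - cmod z)" using near[OF z] d by (intro w_le) auto
      also have "\<dots> \<le> (1 / 2) ^ j / d" using near[OF z] d by (intro divide_left_mono mult_pos_pos) auto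
      finally show "norm (w j z) \<le> (1 / 2) ^ j * (1 / d)" by simp
    qed
    moreover have "cball x d \<subseteq> ball 0 1" using near d by fastforce
    ultimately show "\<exists>d>0. cball x d \<subseteq> ball 0 1
        \<and> uniform_limit (cball x d) (\<lambda>n z. \<Sum>j<n. w j z) u sequentially"
      using d unfolding u_def[abs_def] by blast
  qed simp
  have u_R: "cmod (u z) \<le> 2 * B * R z powr \<eta>" if z: "cmod z < 1" for z
  proof -
    have le: "norm (w j z) \<le> (1 / 2) ^ j * (B * R z powr \<eta>)" for j
    proof -
      have "norm (w j z) \<le> 4 ^ j * (B * e (a j) powr \<eta> * R z powr \<eta>)"
        unfolding w_norm using v_R[OF z] by (intro mult_left_mono) auto
      also have "\<dots> = (8 ^ j * e (a j) powr \<eta>) * ((1 / 2) ^ j * (B * R z powr \<eta>))"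
        unfolding half by simp
      also have "\<dots> \<le> 1 * ((1 / 2) ^ j * (B * R z powr \<eta>))"
        using a1(4)[of j] B0 by (intro mult_right_mono) auto
      finally show ?thesis by simp
    qed
    have "norm (u z) \<le> (\<Sum>j. norm (w j z))"
      unfolding u_def by (rule summable_norm[OF w_sum[OF z]])
    also have "\<dots> \<le> (\<Sum>j. (1 / 2) ^ j * (B * R z powr \<eta>))"
      by (intro suminf_le le w_sum z summable_mult2 sg)
    also have "\<dots> = 2 * (B * R z powr \<eta>)"
      using suminf_mult2[OF sg(1), of "B * R z powr \<eta>"] sg(2) by simp
    finally show ?thesis by simp
  qed
  \<comment> \<open>The term of index \<open>m\<close> is \<open>4 ^ m\<close> at
    \<open>a m\<close>. The earlier ones, at most \<open>2 * 4 ^ j\<close> each, add up to at most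
    two thirds of that, which needs a ratio above 3; the later ones add up to at most 2.\<close>
  have u_big: "4 ^ m / 3 - 2 \<le> cmod (u (a m))" for m
  proof -
    let ?z = "a m"
    have tail: "norm (w (j + Suc m) ?z) \<le> (1 / 2) ^ j" for j
    proof -
      let ?j = "j + Suc m"
      have "norm (w ?j ?z) \<le> 4 ^ ?j * (e (a ?j) / (1 - cmod ?z))"
        unfolding w_norm using v_le[OF a1(1)] by (intro mult_left_mono) auto
      also have "\<dots> = (8 ^ ?j * e (a ?j)) * ((1 / 2) ^ ?j / (1 - cmod ?z))" by (rule half')
      also have "\<dots> \<le> (e ?z / 2) * ((1 / 2) ^ ?j / (1 - cmod ?z))"
        using e_dec[of m ?j] a1(1)[of m] by (intro mult_right_mono) auto
      also have "\<dots> \<le> (1 - cmod ?z) * ((1 / 2) ^ ?j / (1 - cmod ?z))"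
        using e(3)[OF a1(1)[of m]] a1(1)[of m] by (intro mult_right_mono) auto
      also have "\<dots> = (1 / 2) ^ ?j"
      proof -
        have "y * (x / y) = x" if "y \<noteq> 0" for x y :: real using that by simp
        moreover have "1 - cmod ?z \<noteq> 0" using a1(1)[of m] by simp
        ultimately show ?thesis by blast
      qed
      also have "\<dots> \<le> (1 / 2) ^ j" by (intro power_decreasing) auto
      finally show ?thesis .
    qed
    have summ: "summable (\<lambda>j. w j ?z)" by (rule summable_norm_cancel[OF w_sum[OF a1(1)]])
    have summ': "summable (\<lambda>j. norm (w (j + Suc m) ?z))"
      using w_sum[OF a1(1)[of m]] by (subst summable_iff_shift)
    have "u ?z = (\<Sum>j. w (j + Suc m) ?z) + (\<Sum>j<Suc m. w j ?z)"
      unfolding u_def by (rule suminf_split_initial_segment[OF summ])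
    also have "\<dots> = (\<Sum>j. w (j + Suc m) ?z) + (\<Sum>j<m. w j ?z) + 4 ^ m"
      using v_a[of m] by (simp add: w_def)
    finally have "4 ^ m = u ?z - (\<Sum>j. w (j + Suc m) ?z) - (\<Sum>j<m. w j ?z)" by simp
    then have "4 ^ m = cmod (u ?z - (\<Sum>j. w (j + Suc m) ?z) - (\<Sum>j<m. w j ?z))"
      by (metis norm_numeral norm_power)
    also have "\<dots> \<le> cmod (u ?z) + cmod (\<Sum>j. w (j + Suc m) ?z) + cmod (\<Sum>j<m. w j ?z)"
      by (meson add_mono norm_triangle_ineq4 order_refl order_trans)
    also have "cmod (\<Sum>j. w (j + Suc m) ?z) \<le> 2"
    proof -
      have "cmod (\<Sum>j. w (j + Suc m) ?z) \<le> (\<Sum>j. norm (w (j + Suc m) ?z))"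
        by (rule summable_norm[OF summ'])
      also have "\<dots> \<le> (\<Sum>j. (1 / 2) ^ j)" by (intro suminf_le tail summ' sg)
      finally show ?thesis using sg by simp
    qed
    also have "cmod (\<Sum>j<m. w j ?z) \<le> 2 * (4 ^ m / 3)"
    proof -
      have "cmod (\<Sum>j<m. w j ?z) \<le> (\<Sum>j<m. 4 ^ j * 2)"
        by (rule sum_norm_le) (use v_le2[OF a1(1)] in \<open>auto simp: w_norm intro: mult_left_mono\<close>)
      also have "\<dots> = 2 * ((4 ^ m - 1) / 3)"
        using geometric_sum[of "4::real" m] by (simp add: sum_distrib_right[symmetric])
      also have "\<dots> \<le> 2 * (4 ^ m / 3)" by simp
      finally show ?thesis .
    qed
    finally show ?thesis by simp
  qed
  have unb: "\<not> bounded (u ` ball 0 1)"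
  proof
    assume "bounded (u ` ball 0 1)"
    then obtain b where "\<forall>y\<in>u ` ball 0 1. cmod y \<le> b"
      unfolding bounded_iff by blast
    then have b: "cmod (u z) \<le> b" if "cmod z < 1" for z using that by auto
    obtain m where "3 * (b + 2) < (4::real) ^ m" using real_arch_pow[of 4 "3 * (b + 2)"] by auto
    then show False using u_big[of m] b[OF a1(1)[of m]] by simp
  qed
  show ?thesis
    by (rule that[OF u_hol _ _ unb, of "2 * B"]) (use B0 u_R in \<open>auto simp: R_def\<close>)
qed

section \<open>Passage to a Borel measurable weight, and the conclusion\<close>

lemma nn_integral_area_measure:
  assumes "g \<in> borel_measurable borel"
  shows "(\<integral>\<^sup>+z. g z \<partial>area_measure) = ennreal (1 / pi) * (\<integral>\<^sup>+z. g z \<partial>lborel)"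
proof -
  have "g \<in> borel_measurable lebesgue" using assms by (simp add: measurable_completion)
  then show ?thesis
    unfolding area_measure_def by (simp add: nn_integral_scale_measure nn_integral_completion)
qed

lemma borel_measurable_indicator_disk:
  assumes "f holomorphic_on unit_disk"
  shows "(\<lambda>z. indicator unit_disk z *\<^sub>R f z) \<in> borel_measurable borel"
  by (rule borel_measurable_continuous_on_indicator)
     (use holomorphic_on_imp_continuous_on[OF assms] in auto)

text \<open>The weight itself need not be Borel measurable; its regularization \<open>W\<close> is.\<close>

lemma bergman_space_iff:
  fixes W :: "complex \<Rightarrow> real"
  assumes W[measurable]: "W \<in> borel_measurable borel" and k: "0 < k"
    and le: "\<And>z. cmod z < 1 \<Longrightarrow> \<omega> z \<le> k * W z" "\<And>z. cmod z < 1 \<Longrightarrow> W z \<le> k * \<omega> z"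
    and f: "f holomorphic_on unit_disk"
  shows "f \<in> bergman_space p \<omega> \<longleftrightarrow>
    (\<integral>\<^sup>+z\<in>unit_disk. ennreal (cmod (f z) powr p * W z) \<partial>lborel) < \<infinity>"
proof -
  \<comment> \<open>The values of \<open>f\<close> off the disk are arbitrary; the cut-off makes it
    Borel measurable.\<close>
  define g where "g z = indicator unit_disk z *\<^sub>R f z" for z
  have [measurable]: "g \<in> borel_measurable borel" "unit_disk \<in> sets borel"
    unfolding g_def[abs_def] using borel_measurable_indicator_disk[OF f] by auto
  define G where "G z = ennreal (cmod (g z) powr p * W z) * indicator unit_disk z" for z
  have G[measurable]: "G \<in> borel_measurable borel" unfolding G_def[abs_def] by measurable
  have G_eq: "G z = ennreal (cmod (f z) powr p * W z) * indicator unit_disk z" for z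
    by (simp add: G_def g_def indicator_def)
  let ?I = "\<integral>\<^sup>+z\<in>unit_disk. ennreal (cmod (f z) powr p * \<omega> z) \<partial>area_measure"
  let ?J = "\<integral>\<^sup>+z. G z \<partial>lborel"
  have sets: "G \<in> borel_measurable area_measure"
  proof -
    have "G \<in> borel_measurable lebesgue" using G by (simp add: measurable_completion)
    then show ?thesis
      using measurable_cong_sets[of area_measure lebesgue borel borel] by (simp add: area_measure_def)
  qed
  have "?I \<le> (\<integral>\<^sup>+z. ennreal k * G z \<partial>area_measure)"
  proof (rule nn_integral_mono)
    fix z
    show "ennreal (cmod (f z) powr p * \<omega> z) * indicator unit_disk z \<le> ennreal k * G z"
    proof (cases "cmod z < 1")
      case True
      have "cmod (f z) powr p * \<omega> z \<le> k * (cmod (f z) powr p * W z)"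
        using mult_left_mono[OF le(1)[OF True], of "cmod (f z) powr p"] by (simp add: mult_ac)
      then have "ennreal (cmod (f z) powr p * \<omega> z) \<le> ennreal k * ennreal (cmod (f z) powr p * W z)"
        using k by (simp add: ennreal_mult'[symmetric] ennreal_leI)
      then show ?thesis using True by (simp add: G_eq)
    qed simp
  qed
  also have "\<dots> = ennreal k * (ennreal (1 / pi) * ?J)"
    by (simp add: nn_integral_cmult[OF sets] nn_integral_area_measure[OF G])
  finally have 1: "?I \<le> ennreal k * (ennreal (1 / pi) * ?J)" .
  have "ennreal (1 / k) * (ennreal (1 / pi) * ?J) = (\<integral>\<^sup>+z. ennreal (1 / k) * G z \<partial>area_measure)"
    by (simp add: nn_integral_cmult[OF sets] nn_integral_area_measure[OF G])
  also have "\<dots> \<le> ?I"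
  proof (rule nn_integral_mono)
    fix z
    show "ennreal (1 / k) * G z \<le> ennreal (cmod (f z) powr p * \<omega> z) * indicator unit_disk z"
    proof (cases "cmod z < 1")
      case True
      have "1 / k * (cmod (f z) powr p * W z) \<le> cmod (f z) powr p * \<omega> z"
        using mult_left_mono[OF le(2)[OF True], of "cmod (f z) powr p"] k
        by (simp add: pos_divide_le_eq mult_ac)
      then have "ennreal (1 / k) * ennreal (cmod (f z) powr p * W z) \<le> ennreal (cmod (f z) powr p * \<omega> z)"
        using k by (simp add: ennreal_mult'[symmetric] ennreal_leI del: times_divide_eq_left)
      then show ?thesis using True by (simp add: G_eq)
    qed (simp add: G_eq)
  qed
  finally have 2: "ennreal (1 / k) * (ennreal (1 / pi) * ?J) \<le> ?I" .
  have "?I < \<infinity> \<longleftrightarrow> ?J < \<infinity>"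
  proof
    assume "?I < \<infinity>"
    with 2 have "ennreal (1 / k) * (ennreal (1 / pi) * ?J) < top" by (simp add: order_le_less_trans)
    then show "?J < \<infinity>" using k by (auto simp: ennreal_mult_less_top)
  next
    assume "?J < \<infinity>"
    then have "ennreal k * (ennreal (1 / pi) * ?J) < top" by (simp add: ennreal_mult_less_top)
    with 1 show "?I < \<infinity>" by (simp add: order_le_less_trans)
  qed
  then show ?thesis using f by (simp add: bergman_space_def G_eq)
qed

theorem theorem6:
  fixes p :: real and \<phi> :: "complex \<Rightarrow> complex" and \<omega> :: "complex \<Rightarrow> real"
  assumes "1 < p"
    and "\<phi> holomorphic_on unit_disk" and "\<phi> ` unit_disk \<subseteq> unit_disk"
    and "regular_weight \<omega>"
    and "\<exists>C>0. \<forall>r t. 0 \<le> r \<and> r \<le> t \<and> t < 1 \<longrightarrow>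
           tail_integral \<omega> ((t - r) / (1 - t * r)) * tail_integral \<omega> r \<le> C * tail_integral \<omega> t"
    and "2 * lower_tail_ratio \<omega> + lower_tail_ratio \<omega> * upper_tail_ratio \<omega>
           - upper_tail_ratio \<omega> > 0"
    and "{u. u holomorphic_on unit_disk \<and>
            weighted_comp u \<phi> ` bergman_space p \<omega> \<subseteq> bergman_space p \<omega>} = H_infinity"
  shows "finite_blaschke_product \<phi>"
proof (rule ccontr)
  assume not_blaschke: "\<not> finite_blaschke_product \<phi>"
  note p = assms(1) and hol_phi = assms(2) and self_phi = assms(3)
  have f1: "cmod (\<phi> z) < 1" if "cmod z < 1" for z
    using self_phi that by (auto simp: image_subset_iff)
  have "\<not> (\<forall>c<1. \<exists>s<1. \<forall>z. s < cmod z \<and> cmod z < 1 \<longrightarrow> c < cmod (\<phi> z))"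
    using proper_imp_finite_blaschke_product[OF hol_phi] f1 not_blaschke by (meson less_imp_le)
  then obtain c where c: "c < 1"
    "\<And>s. s < 1 \<Longrightarrow> \<exists>z. s < cmod z \<and> cmod z < 1 \<and> cmod (\<phi> z) \<le> c"
    by (fastforce simp: not_less)

  define h where "h r = tail_integral \<omega> (max 0 (min r 1))" for r
  obtain C where C: "regular_tail h C"
    "\<And>r. \<lbrakk>0 < r; r < 1\<rbrakk> \<Longrightarrow> \<omega> (of_real r) \<le> C * (tail_integral \<omega> r / (1 - r))"
    "\<And>r. \<lbrakk>0 < r; r < 1\<rbrakk> \<Longrightarrow> tail_integral \<omega> r / (1 - r) \<le> C * \<omega> (of_real r)"
    "h \<in> borel_measurable borel"
    unfolding h_def[abs_def] using regular_weight_tail[OF assms(4)] by blast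
  interpret regular_tail h C by (rule C(1))
  obtain \<delta> where \<delta>_le: "0 < \<delta>" "\<delta> \<le> 1 / 2" "decay_rate * 2 powr \<delta> < 1"
    using ex_decay_exponent by blast
  \<comment> \<open>Extension of \<open>\<phi>\<close> by 0, to have a Borel map on the whole
    plane.\<close>
  define \<psi> where "\<psi> z = indicator unit_disk z *\<^sub>R \<phi> z" for z
  have \<psi>: "\<psi> z = \<phi> z" if "cmod z < 1" for z using that by (simp add: \<psi>_def)
  interpret weighted_self_map \<psi> h C \<delta>
  proof
    show "\<psi> holomorphic_on unit_disk" by (rule holomorphic_transform[OF hol_phi]) (simp add: \<psi>)
    show "\<psi> ` unit_disk \<subseteq> unit_disk" using f1 \<psi> by auto
    show "\<psi> \<in> borel_measurable borel"
      unfolding \<psi>_def[abs_def] by (rule borel_measurable_indicator_disk[OF hol_phi])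
  qed (use \<delta>_le C(4) in auto)

  have w: "0 < \<omega> z" "\<omega> z = \<omega> (of_real (cmod z))" if "cmod z < 1" for z
  proof -
    have "z \<in> unit_disk" using that by simp
    then show "0 < \<omega> z" "\<omega> z = \<omega> (of_real (cmod z))"
      using assms(4) unfolding regular_weight_def weight_def by blast+
  qed
  have W0: "0 < W 0" using pos[of 0] by (simp add: W_def)
  \<comment> \<open>The two quotients at 0 enter because regularity compares \<open>\<omega>\<close>
    with its tail only at positive radii.\<close>
  define k where "k = max C (max (\<omega> 0 / W 0) (W 0 / \<omega> 0))"
  have k: "0 < k" using C_pos by (simp add: k_def)
  have "\<omega> z \<le> k * W z \<and> W z \<le> k * \<omega> z" if z: "cmod z < 1" for z
  proof (cases "z = 0")
    case True
    have "\<omega> 0 / W 0 \<le> k" "W 0 / \<omega> 0 \<le> k" by (auto simp: k_def)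
    then show ?thesis using True W0 w(1)[of 0] by (simp add: pos_divide_le_eq)
  next
    case False
    have W: "W z = tail_integral \<omega> (cmod z) / (1 - cmod z)"
      using z by (simp add: W_def h_def)
    have "\<omega> z \<le> C * W z" "W z \<le> C * \<omega> z"
      unfolding W w(2)[OF z] using C(2,3)[of "cmod z"] z False by auto
    moreover have "C * W z \<le> k * W z" "C * \<omega> z \<le> k * \<omega> z"
      using W_nonneg[OF z] w(1)[OF z] by (auto intro!: mult_right_mono simp: k_def)
    ultimately show ?thesis by linarith
  qed
  then have bergman: "f \<in> bergman_space p \<omega> \<longleftrightarrow>
      (\<integral>\<^sup>+z\<in>unit_disk. ennreal (cmod (f z) powr p * W z) \<partial>lborel) < \<infinity>"
    if "f holomorphic_on unit_disk" for f
    using bergman_space_iff[OF W_meas k _ _ that] by blast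

  \<comment> \<open>The \<open>p\<close>-th power of \<open>|u| \<le> M * R powr \<eta>\<close> then
    has exactly the gain \<open>R powr \<delta>\<close> of the composition estimate.\<close>
  define \<eta> where "\<eta> = \<delta> / p"
  have \<eta>: "0 < \<eta>" "\<eta> \<le> 1 / 2" using \<delta>_le p by (auto simp: \<eta>_def field_simps)
  obtain u M where u: "u holomorphic_on unit_disk" "0 \<le> M"
    "\<And>z. cmod z < 1 \<Longrightarrow> cmod (u z) \<le> M * ((1 - cmod (\<phi> z)) / (1 - cmod z)) powr \<eta>"
    "\<not> bounded (u ` unit_disk)"
    using gliding_hump[OF hol_phi self_phi c \<eta>] by blast
  obtain N where N: "0 \<le> N"
    "\<And>f. \<lbrakk>f holomorphic_on unit_disk; f \<in> borel_measurable borel\<rbrakk> \<Longrightarrow>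
      (\<integral>\<^sup>+z\<in>unit_disk. ennreal (cmod (f (\<psi> z)) powr p
          * (((1 - cmod (\<psi> z)) / (1 - cmod z)) powr \<delta> * W z)) \<partial>lborel)
      \<le> ennreal N * (\<integral>\<^sup>+z\<in>unit_disk. ennreal (cmod (f z) powr p * W z) \<partial>lborel)"
    using weighted_composition_estimate[OF p] by blast
  have "weighted_comp u \<phi> f \<in> bergman_space p \<omega>" if f: "f \<in> bergman_space p \<omega>" for f
  proof -
    have holf: "f holomorphic_on unit_disk" using f by (simp add: bergman_space_def)
    define g where "g z = indicator unit_disk z *\<^sub>R f z" for z
    have g: "g z = f z" if "cmod z < 1" for z using that by (simp add: g_def)
    have [measurable]: "g \<in> borel_measurable borel" "unit_disk \<in> sets borel"
      unfolding g_def[abs_def] using borel_measurable_indicator_disk[OF holf] by auto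
    have holg: "g holomorphic_on unit_disk"
      by (rule holomorphic_transform[OF holf]) (simp add: g)
    have holu: "weighted_comp u \<phi> f holomorphic_on unit_disk"
      unfolding weighted_comp_def
      using holomorphic_on_compose_gen[OF hol_phi holf self_phi] u(1)
      by (auto intro!: holomorphic_intros simp: comp_def)
    let ?F = "\<lambda>z. ennreal (cmod (g (\<psi> z)) powr p
          * (((1 - cmod (\<psi> z)) / (1 - cmod z)) powr \<delta> * W z)) * indicator unit_disk z"
    have "(\<integral>\<^sup>+z\<in>unit_disk. ennreal (cmod (weighted_comp u \<phi> f z) powr p * W z) \<partial>lborel)
        \<le> (\<integral>\<^sup>+z. ennreal (M powr p) * ?F z \<partial>lborel)"
    proof (rule nn_integral_mono)
      fix z
      show "ennreal (cmod (weighted_comp u \<phi> f z) powr p * W z) * indicator unit_disk z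
          \<le> ennreal (M powr p) * ?F z"
      proof (cases "cmod z < 1")
        case True
        let ?R = "(1 - cmod (\<phi> z)) / (1 - cmod z)"
        have "cmod (u z) powr p \<le> (M * ?R powr \<eta>) powr p"
          using u(3)[OF True] p by (intro powr_mono2) auto
        also have "\<dots> = M powr p * ?R powr \<delta>"
          using p by (simp add: powr_mult powr_powr \<eta>_def)
        finally have "cmod (u z) powr p * (cmod (f (\<phi> z)) powr p * W z)
            \<le> M powr p * ?R powr \<delta> * (cmod (f (\<phi> z)) powr p * W z)"
          using W_nonneg[OF True] by (intro mult_right_mono) auto
        then have "cmod (weighted_comp u \<phi> f z) powr p * W z
            \<le> M powr p * (cmod (g (\<psi> z)) powr p * (((1 - cmod (\<psi> z)) / (1 - cmod z)) powr \<delta> * W z))"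
          using True f1 by (simp add: weighted_comp_def norm_mult powr_mult \<psi> g mult_ac)
        then have "ennreal (cmod (weighted_comp u \<phi> f z) powr p * W z)
            \<le> ennreal (M powr p) * ennreal (cmod (g (\<psi> z)) powr p
                * (((1 - cmod (\<psi> z)) / (1 - cmod z)) powr \<delta> * W z))"
          by (subst ennreal_mult'[symmetric]) (auto intro: ennreal_leI)
        then show ?thesis using True by simp
      qed simp
    qed
    also have "\<dots> = ennreal (M powr p) * (\<integral>\<^sup>+z. ?F z \<partial>lborel)"
      by (rule nn_integral_cmult) measurable
    also have "\<dots> \<le> ennreal (M powr p) * (ennreal N * (\<integral>\<^sup>+z\<in>unit_disk. ennreal (cmod (g z) powr p * W z) \<partial>lborel))"
      by (intro mult_left_mono N(2) holg) auto
    also have "\<dots> < \<infinity>"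
    proof -
      have "(\<integral>\<^sup>+z\<in>unit_disk. ennreal (cmod (g z) powr p * W z) \<partial>lborel)
          = (\<integral>\<^sup>+z\<in>unit_disk. ennreal (cmod (f z) powr p * W z) \<partial>lborel)"
        by (intro nn_integral_cong) (auto simp: g indicator_def)
      then show ?thesis using f bergman[OF holf] by (simp add: ennreal_mult_less_top)
    qed
    finally show ?thesis using bergman[OF holu] by blast
  qed
  then have "u \<in> H_infinity" using u(1) assms(7) by blast
  then show False using u(4) by (simp add: H_infinity_def)
qed

end
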